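(* For $E>0$ let \[ \kappa_{\mathrm{U}(1)}(E):=\min_{\varphi\in L^2_{p,\mathrm{even},n}((-\pi,\pi])}\{\langle\varphi|I-\cos Q|\varphi\rangle:\langle\varphi|P^2|\varphi\rangle\le E\}. \] Then \[ \kappa_{\mathrm{U}(1)}(E)=\max_{s>0}\Big(\frac{s\,a_0(2/s)}{4}+1-sE\Big). \] Moreover, in the $\mathrm{U}(1)$ estimation problem of the context, the minimum $\kappa_{\mathrm{U}(1)}(E)$ is attained by an input state $|\phi\rangle\in\ell^2(\mathbb{Z})$ (with $\langle\phi|H|\phi\rangle\le E$) together with the measurement $M_{|\mathcal{I}\rangle\langle\mathcal{I}|}$ if and only if $\mathcal{F}^{-1}[\phi](\theta)=\mathrm{ce}_0(\theta/2,-2/s_E)$, where $s_E=\mathrm{argmax}_{s>0}\big(\frac{s\,a_0(2/s)}{4}+1-sE\big)$.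
   Context: $L^2_p((-\pi,\pi])$ is the space of $2\pi$-periodic square-integrable functions with inner product $\int_{-\pi}^{\pi}\bar\varphi\psi\,\frac{d\theta}{2\pi}$; $L^2_{p,\mathrm{even},n}$ are its even unit vectors; $Q$ is multiplication by $\theta$, $P=-i\,d/d\theta$. For real $q$, $a_0(q)$ is the smallest eigenvalue of the operator $-\frac{d^2}{dx^2}+2q\cos 2x$ on even $\pi$-periodic functions (the smallest $a$ for which Mathieu's equation $y''+(a-2q\cos2x)y=0$ has a nonzero even $\pi$-periodic solution), and $\mathrm{ce}_0(\cdot,q)$ is a corresponding eigenfunction (Mathieu function). $\mathrm{U}(1)$ estimation problem: $\mathrm{U}(1)\cong(-\pi,\pi]$ acts on $\ell^2(\mathbb{Z})$ (basis $|k\rangle$) by $f(\theta)=\sum_ke^{ik\theta}|k\rangle\langle k|$; Hamiltonian $H=\sum_kk^2|k\rangle\langle k|$; risk $R(\theta,\hat\theta)=1-\cos(\hat\theta-\theta)$. For $\phi=\sum\phi(k)|k\rangle$, $\mathcal{F}^{-1}[\phi](\theta)=\sum_ke^{-ik\theta}\phi(k)$. $M_{|\mathcal{I}\rangle\langle\mathcal{I}|}$ is the covariant POVM $M(B)=\int_Bf(\theta)|\mathcal{I}\rangle\langle\mathcal{I}|f(\theta)^\dagger\frac{d\theta}{2\pi}$ with $|\mathcal{I}\rangle=\sum_k|k\rangle$, whose error for input $|\phi\rangle$ is $\int_{-\pi}^{\pi}(1-\cos\hat\theta)|\mathcal{F}^{-1}[\phi](\hat\theta)|^2\frac{d\hat\theta}{2\pi}$.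 *)

theory Defs
  imports "HOL-Analysis.Analysis"
begin

definition mathieu_eigfun :: "real \<Rightarrow> real \<Rightarrow> (real \<Rightarrow> real) \<Rightarrow> bool" where
  "mathieu_eigfun q a y \<longleftrightarrow>
     (\<exists>x. y x \<noteq> 0) \<and> (\<forall>x. y (x + pi) = y x) \<and> (\<forall>x. y (- x) = y x) \<and>
     (\<exists>y' y''. (\<forall>x. (y has_real_derivative y' x) (at x)) \<and>
               (\<forall>x. (y' has_real_derivative y'' x) (at x)) \<and>
               (\<forall>x. y'' x + (a - 2 * q * cos (2 * x)) * y x = 0))"

definition a0 :: "real \<Rightarrow> real" where
  "a0 q = Inf {a. \<exists>y. mathieu_eigfun q a y}"

definition L2p_even_unit :: "(real \<Rightarrow> complex) set" where
  "L2p_even_unit = {f. f \<in> borel_measurable borel \<and>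
      set_integrable lborel {-pi<..pi} (\<lambda>\<theta>. (cmod (f \<theta>))\<^sup>2) \<and>
      (\<forall>\<theta>\<in>{-pi<..<pi}. f (- \<theta>) = f \<theta>) \<and>
      (LINT \<theta>:{-pi<..pi}|lborel. (cmod (f \<theta>))\<^sup>2) / (2 * pi) = 1}"

text \<open>Fourier coefficient <e_k|f> w.r.t. the orthonormal basis e_k(theta) = exp(i k theta)
  of L^2_p with inner product int conj(phi) psi dtheta/(2 pi). P = -i d/dtheta acts as
  e_k |-> k e_k, so <f|P^2|f> = sum_k k^2 |<e_k|f>|^2 (finite iff f is in the form domain).\<close>
definition fourier_coeff :: "(real \<Rightarrow> complex) \<Rightarrow> int \<Rightarrow> complex" where
  "fourier_coeff f k =
     (LINT \<theta>:{-pi<..pi}|lborel. exp (- (\<i> * of_int k * of_real \<theta>)) * f \<theta>) / (2 * pi)"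

definition finite_P2 :: "(real \<Rightarrow> complex) \<Rightarrow> bool" where
  "finite_P2 f \<longleftrightarrow> (\<lambda>k. (of_int k)\<^sup>2 * (cmod (fourier_coeff f k))\<^sup>2 :: real) summable_on UNIV"

definition P2_expect :: "(real \<Rightarrow> complex) \<Rightarrow> real" where
  "P2_expect f = (\<Sum>\<^sub>\<infinity>k. (of_int k)\<^sup>2 * (cmod (fourier_coeff f k))\<^sup>2)"

definition one_minus_cosQ_expect :: "(real \<Rightarrow> complex) \<Rightarrow> real" where
  "one_minus_cosQ_expect f =
     (LINT \<theta>:{-pi<..pi}|lborel. (1 - cos \<theta>) * (cmod (f \<theta>))\<^sup>2) / (2 * pi)"

definition kappa_U1 :: "real \<Rightarrow> real" where
  "kappa_U1 E = Inf (one_minus_cosQ_expect `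
      {f \<in> L2p_even_unit. finite_P2 f \<and> P2_expect f \<le> E})"

definition mathieu_obj :: "real \<Rightarrow> real \<Rightarrow> real" where
  "mathieu_obj E s = s * a0 (2 / s) / 4 + 1 - s * E"

definition l2_unit :: "(int \<Rightarrow> complex) \<Rightarrow> bool" where
  "l2_unit \<phi> \<longleftrightarrow> (\<lambda>k. (cmod (\<phi> k))\<^sup>2) summable_on UNIV \<and> (\<Sum>\<^sub>\<infinity>k. (cmod (\<phi> k))\<^sup>2) = 1"

definition finite_H :: "(int \<Rightarrow> complex) \<Rightarrow> bool" where
  "finite_H \<phi> \<longleftrightarrow> (\<lambda>k. (of_int k)\<^sup>2 * (cmod (\<phi> k))\<^sup>2 :: real) summable_on UNIV"

definition H_expect :: "(int \<Rightarrow> complex) \<Rightarrow> real" where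
  "H_expect \<phi> = (\<Sum>\<^sub>\<infinity>k. (of_int k)\<^sup>2 * (cmod (\<phi> k))\<^sup>2)"

definition Finv :: "(int \<Rightarrow> complex) \<Rightarrow> real \<Rightarrow> complex" where
  "Finv \<phi> \<theta> = (\<Sum>\<^sub>\<infinity>k. exp (- (\<i> * of_int k * of_real \<theta>)) * \<phi> k)"

definition covI_error :: "(int \<Rightarrow> complex) \<Rightarrow> real" where
  "covI_error \<phi> =
     (LINT \<theta>:{-pi<..pi}|lborel. (1 - cos \<theta>) * (cmod (Finv \<phi> \<theta>))\<^sup>2) / (2 * pi)"

end

theory Submission
  imports Defs
begin

text \<open>In Fourier coefficients the problem is to minimize 1 - hop u, where hop u is the sum of
  u(k) u(k+1), over unit sequences on the integers with energy, the sum of k^2 u(k)^2, at most E.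
  Energy sublevel sets are compact, so minimizers exist. As a function of the squares u(k)^2 the
  energy is linear and hop is concave, so the minimal value is convex in E; a supporting line gives
  a multiplier s > 0 and strong duality with the bottom of the spectrum of 1 - cos Q + s P^2. The
  ground state of that operator is unique up to a factor, because its absolute value is again a
  ground state and the three-term eigenvalue recurrence propagates zeros. Substituting
  \<theta> = 2x turns the recurrence into Mathieu's equation with q = -2/s and eigenvalue
  a = 4 (l - 1) / s; translation by pi/2 exchanges q and -q.\<close>

subsection \<open>Square-summable sequences with finite energy\<close>

text \<open>Three descriptions have to meet: wave functions are measurable representatives,
  \<open>P2_expect\<close> is defined by Fourier coefficients, and \<open>a0\<close> by classical
  solutions of an ODE. Sequences are the common ground. Finite energy makes the translation cheap,
  because it forces absolutely summable coefficients: besides absolutely convergent Fourier series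
  only one fact is needed, that the coefficients determine an integrable function almost everywhere.
  All forms have real coefficients, so a complex state splits into its real and imaginary parts.
  These parts need not obey the energy bound separately, whereas the bound by the form with
  multiplier s is additive; hence complex states are compared with the optimum through the dual
  problem. Evenness is not imposed on sequences: ground states are even automatically. Uniqueness of
  the ground state serves the converse of the characterization as well. A minimizer of the dual form
  could a priori trade energy against error; being proportional to a primal minimizer, it has the
  optimal error.\<close>

lemma infsum_dominated_convergence:
  fixes f :: "nat \<Rightarrow> 'a \<Rightarrow> 'b::{banach, second_countable_topology}"
  assumes lim: "\<And>k. (\<lambda>n. f n k) \<longlonglongrightarrow> g k"
    and bound: "\<And>n k. norm (f n k) \<le> M k"
    and M: "M summable_on UNIV"
  shows "(\<lambda>k. norm (g k)) summable_on UNIV" "(\<lambda>n. infsum (f n) UNIV) \<longlonglongrightarrow> infsum g UNIV"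
proof -
  have f_abs: "(\<lambda>k. norm (f n k)) summable_on UNIV" for n
    using Infinite_Sum.abs_summable_on_comparison_test'[OF M] bound by blast
  have g_bound: "norm (g k) \<le> M k" for k
    by (rule LIMSEQ_le_const2[OF tendsto_norm[OF lim]]) (use bound in auto)
  show g_abs: "(\<lambda>k. norm (g k)) summable_on UNIV"
    using Infinite_Sum.abs_summable_on_comparison_test'[OF M] g_bound by blast
  have "0 \<le> M k" for k
    using order_trans[OF norm_ge_zero bound] .
  then have M_abs: "(\<lambda>k. norm (M k)) summable_on UNIV"
    using M by simp
  \<comment> \<open>Read as integrals against counting measure, the sums fall under the dominated
    convergence theorem for integrals.\<close>
  then have M_int: "integrable (count_space UNIV) M"
    by (simp only: abs_summable_equivalent Infinite_Set_Sum.abs_summable_on_def)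
  have "(\<lambda>n. infsetsum (f n) UNIV) \<longlonglongrightarrow> infsetsum g UNIV"
    unfolding infsetsum_def
    by (rule integral_dominated_convergence[where w = M])
       (use M_int lim bound in auto)
  then show "(\<lambda>n. infsum (f n) UNIV) \<longlonglongrightarrow> infsum g UNIV"
    using f_abs g_abs by (simp add: infsetsum_infsum abs_summable_equivalent)
qed

lemma summable_on_shift_int:
  fixes f :: "int \<Rightarrow> 'a::{comm_monoid_add, t2_space}"
  shows "(\<lambda>k. f (k + m)) summable_on UNIV \<longleftrightarrow> f summable_on UNIV"
    "(\<Sum>\<^sub>\<infinity>k. f (k + m)) = (\<Sum>\<^sub>\<infinity>k. f k)"
proof -
  have b: "bij_betw (\<lambda>k::int. k + m) UNIV UNIV"
    by (rule bij_betwI[where g = "\<lambda>k. k - m"]) auto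
  show "(\<lambda>k. f (k + m)) summable_on UNIV \<longleftrightarrow> f summable_on UNIV"
    by (rule summable_on_reindex_bij_betw[OF b])
  show "(\<Sum>\<^sub>\<infinity>k. f (k + m)) = (\<Sum>\<^sub>\<infinity>k. f k)"
    by (rule infsum_reindex_bij_betw[OF b])
qed

lemma summable_on_uminus_int:
  fixes f :: "int \<Rightarrow> 'a::{comm_monoid_add, t2_space}"
  shows "(\<lambda>k. f (- k)) summable_on UNIV \<longleftrightarrow> f summable_on UNIV"
    "(\<Sum>\<^sub>\<infinity>k. f (- k)) = (\<Sum>\<^sub>\<infinity>k. f k)"
proof -
  have b: "bij_betw (uminus :: int \<Rightarrow> int) UNIV UNIV"
    by (rule bij_betwI[where g = uminus]) auto
  show "(\<lambda>k. f (- k)) summable_on UNIV \<longleftrightarrow> f summable_on UNIV"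
    by (rule summable_on_reindex_bij_betw[OF b])
  show "(\<Sum>\<^sub>\<infinity>k. f (- k)) = (\<Sum>\<^sub>\<infinity>k. f k)"
    by (rule infsum_reindex_bij_betw[OF b])
qed

text \<open>This weight is the majorant behind every estimate from finite energy: it dominates
  squares on sublevel sets and pays for absolute summability.\<close>

lemma summable_on_int_weight: "(\<lambda>k::int. 1 / (1 + (of_int k)\<^sup>2) :: real) summable_on UNIV"
proof -
  let ?w = "\<lambda>k::int. 1 / (1 + (of_int k)\<^sup>2) :: real"
  have *: "summable (\<lambda>n. 1 / (1 + (real n)\<^sup>2))"
  proof (rule summable_comparison_test'[where N = 1])
    show "summable (\<lambda>n. inverse (real n ^ 2))"
      by (rule inverse_power_summable) simp
    show "norm (1 / (1 + (real n)\<^sup>2)) \<le> inverse (real n ^ 2)" if "n \<ge> 1" for n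
      using that by (auto simp: field_simps power2_eq_square add_pos_nonneg)
  qed
  have nat: "(\<lambda>n::nat. 1 / (1 + (real n)\<^sup>2)) summable_on UNIV"
    by (rule summable_nonneg_imp_summable_on[OF *]) simp
  have pos: "?w summable_on range int"
    by (subst summable_on_reindex) (use nat in \<open>auto simp: o_def\<close>)
  have neg: "?w summable_on range (\<lambda>n. - int n)"
    by (subst summable_on_reindex) (use nat in \<open>auto simp: o_def inj_on_def\<close>)
  have "UNIV = range int \<union> range (\<lambda>n. - int n)"
    using int_cases2 by blast
  then show ?thesis
    using summable_on_union[OF pos neg] by simp
qed

text \<open>The form domain of P^2 in Fourier coefficients, that is, the Sobolev space H^1 of the
  circle. The single weight 1 + k^2 controls mass and energy at once.\<close>

definition form_dom :: "(int \<Rightarrow> real) set" where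
  "form_dom = {u. (\<lambda>k. (1 + (of_int k)\<^sup>2) * (u k)\<^sup>2) summable_on UNIV}"

definition mass :: "(int \<Rightarrow> real) \<Rightarrow> real" where
  "mass u = (\<Sum>\<^sub>\<infinity>k. (u k)\<^sup>2)"

definition energy :: "(int \<Rightarrow> real) \<Rightarrow> real" where
  "energy u = (\<Sum>\<^sub>\<infinity>k. (of_int k)\<^sup>2 * (u k)\<^sup>2)"

text \<open>The expectation of cos Q for real coefficients: cos couples each k to k + 1 and k - 1
  with factor 1/2, and both directions contribute the same sum.\<close>

definition hop :: "(int \<Rightarrow> real) \<Rightarrow> real" where
  "hop u = (\<Sum>\<^sub>\<infinity>k. u k * u (k + 1))"

lemma form_dom_iff:
  "u \<in> form_dom \<longleftrightarrow> (\<lambda>k. (u k)\<^sup>2) summable_on UNIV \<and> (\<lambda>k. (of_int k)\<^sup>2 * (u k)\<^sup>2) summable_on UNIV"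
proof
  assume u: "u \<in> form_dom"
  show "(\<lambda>k. (u k)\<^sup>2) summable_on UNIV \<and> (\<lambda>k. (of_int k)\<^sup>2 * (u k)\<^sup>2) summable_on UNIV"
    using u unfolding form_dom_def mem_Collect_eq
    by (auto elim!: summable_on_comparison_test simp: algebra_simps)
next
  assume "(\<lambda>k. (u k)\<^sup>2) summable_on UNIV \<and> (\<lambda>k. (of_int k)\<^sup>2 * (u k)\<^sup>2) summable_on UNIV"
  then show "u \<in> form_dom"
    using summable_on_add[of "\<lambda>k. (u k)\<^sup>2" UNIV "\<lambda>k. (of_int k)\<^sup>2 * (u k)\<^sup>2"]
    by (simp add: form_dom_def algebra_simps)
qed

lemma form_domD:
  assumes "u \<in> form_dom"
  shows "(\<lambda>k. (u k)\<^sup>2) summable_on UNIV" "(\<lambda>k. (of_int k)\<^sup>2 * (u k)\<^sup>2) summable_on UNIV"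
  using assms by (auto simp: form_dom_iff)

lemma abs_mult_le_mean_squares: "\<bar>a * b\<bar> \<le> (a\<^sup>2 + b\<^sup>2) / (2::real)"
  using sum_squares_bound[of "\<bar>a\<bar>" "\<bar>b\<bar>"] by (simp add: abs_mult)

lemma summable_on_mult_square:
  fixes u v :: "'a \<Rightarrow> real"
  assumes "(\<lambda>k. (u k)\<^sup>2) summable_on A" "(\<lambda>k. (v k)\<^sup>2) summable_on A"
  shows "(\<lambda>k. u k * v k) summable_on A"
proof -
  have "(\<lambda>k. ((u k)\<^sup>2 + (v k)\<^sup>2) * (1/2)) summable_on A"
    using assms by (intro summable_on_cmult_left summable_on_add)
  then have "(\<lambda>k. norm (u k * v k)) summable_on A"
    by (rule Infinite_Sum.abs_summable_on_comparison_test') (use abs_mult_le_mean_squares in auto)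
  then show ?thesis
    by (rule abs_summable_summable)
qed

lemma form_dom_hop_summable: "u \<in> form_dom \<Longrightarrow> (\<lambda>k. u k * u (k + 1)) summable_on UNIV"
  using form_domD(1) summable_on_shift_int(1)[of "\<lambda>k. (u k)\<^sup>2" 1]
  by (intro summable_on_mult_square) auto

lemma form_dom_add:
  assumes "u \<in> form_dom" "v \<in> form_dom"
  shows "(\<lambda>k. u k + v k) \<in> form_dom"
  unfolding form_dom_def mem_Collect_eq
proof (rule summable_on_comparison_test)
  show "(\<lambda>k. 2 * ((1 + (of_int k)\<^sup>2) * (u k)\<^sup>2) + 2 * ((1 + (of_int k)\<^sup>2) * (v k)\<^sup>2)) summable_on UNIV"
    using assms unfolding form_dom_def mem_Collect_eq
    by (intro summable_on_add summable_on_cmult_right)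
  fix k :: int
  have "(u k + v k)\<^sup>2 \<le> 2 * (u k)\<^sup>2 + 2 * (v k)\<^sup>2"
    using sum_squares_bound[of "u k" "v k"] by (simp add: power2_sum)
  from mult_left_mono[OF this, of "1 + (of_int k)\<^sup>2"]
  show "(1 + (of_int k)\<^sup>2) * (u k + v k)\<^sup>2 \<le> 2 * ((1 + (of_int k)\<^sup>2) * (u k)\<^sup>2) + 2 * ((1 + (of_int k)\<^sup>2) * (v k)\<^sup>2)"
    by (simp add: algebra_simps)
qed simp

lemma form_dom_scale: "u \<in> form_dom \<Longrightarrow> (\<lambda>k. t * u k) \<in> form_dom"
  using summable_on_cmult_right[of "\<lambda>k. (1 + (of_int k)\<^sup>2) * (u k)\<^sup>2" UNIV "t\<^sup>2"]
  by (simp add: form_dom_def power_mult_distrib mult_ac)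

lemma form_dom_uminus: "u \<in> form_dom \<Longrightarrow> (\<lambda>k. u (- k)) \<in> form_dom"
  using summable_on_uminus_int(1)[of "\<lambda>k. (1 + (of_int k)\<^sup>2) * (u k)\<^sup>2"]
  by (simp add: form_dom_def)

lemma form_dom_abs: "u \<in> form_dom \<Longrightarrow> (\<lambda>k. \<bar>u k\<bar>) \<in> form_dom"
  by (simp add: form_dom_def)

lemma form_dom_finite_support:
  assumes "finite S" "\<And>k. k \<notin> S \<Longrightarrow> u k = 0"
  shows "u \<in> form_dom"
  unfolding form_dom_def mem_Collect_eq
  by (rule finite_nonzero_values_imp_summable_on, rule finite_subset[OF _ assms(1)])
     (use assms(2) in auto)

lemma mass_nonneg: "0 \<le> mass u"
  unfolding mass_def by (rule infsum_nonneg) simp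

lemma energy_nonneg: "0 \<le> energy u"
  unfolding energy_def by (rule infsum_nonneg) simp

lemma mass_abs [simp]: "mass (\<lambda>k. \<bar>u k\<bar>) = mass u"
  by (simp add: mass_def)

lemma energy_abs [simp]: "energy (\<lambda>k. \<bar>u k\<bar>) = energy u"
  by (simp add: energy_def)

lemma mass_scale: "mass (\<lambda>k. t * u k) = t\<^sup>2 * mass u"
  unfolding mass_def power_mult_distrib by (rule infsum_cmult_right')

lemma energy_scale: "energy (\<lambda>k. t * u k) = t\<^sup>2 * energy u"
  unfolding energy_def infsum_cmult_right'[symmetric] by (simp add: power_mult_distrib mult_ac)

lemma hop_scale: "hop (\<lambda>k. t * u k) = t\<^sup>2 * hop u"
  unfolding hop_def infsum_cmult_right'[symmetric] by (simp add: power2_eq_square mult_ac)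

text \<open>The Perron-Frobenius ingredient: passing to absolute values keeps mass and energy, so it
  can only lower \<open>form\<close>.\<close>

lemma hop_le_hop_abs:
  assumes "u \<in> form_dom"
  shows "hop u \<le> hop (\<lambda>k. \<bar>u k\<bar>)"
  unfolding hop_def
  by (rule infsum_mono[OF form_dom_hop_summable[OF assms] form_dom_hop_summable[OF form_dom_abs[OF assms]]])
     (simp add: abs_mult[symmetric])

lemma hop_le_mass:
  assumes "u \<in> form_dom"
  shows "hop u \<le> mass u"
proof -
  have s: "(\<lambda>k. (u k)\<^sup>2) summable_on UNIV" "(\<lambda>k. (u (k+1))\<^sup>2) summable_on UNIV"
    using form_domD(1)[OF assms] summable_on_shift_int(1)[of "\<lambda>k. (u k)\<^sup>2" 1] by auto
  have "hop u \<le> (\<Sum>\<^sub>\<infinity>k. ((u k)\<^sup>2 + (u (k + 1))\<^sup>2) * (1/2))"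
    unfolding hop_def
    by (rule infsum_mono[OF form_dom_hop_summable[OF assms] summable_on_cmult_left[OF summable_on_add[OF s]]])
       (use abs_le_D1[OF abs_mult_le_mean_squares] in auto)
  also have "\<dots> = mass u"
    by (subst infsum_cmult_left', subst infsum_add[OF s])
       (simp add: mass_def summable_on_shift_int(2)[of "\<lambda>k. (u k)\<^sup>2"])
  finally show ?thesis .
qed

lemma mass_add_energy:
  "u \<in> form_dom \<Longrightarrow> mass u + energy u = (\<Sum>\<^sub>\<infinity>k. (1 + (of_int k)\<^sup>2) * (u k)\<^sup>2)"
  using infsum_add[OF form_domD[of u]] by (simp add: mass_def energy_def algebra_simps)

text \<open>Finite sums characterise the sublevel sets of mass plus energy, so these sets are closed
  under pointwise limits.\<close>
lemma form_dom_boundI: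
  assumes "\<And>F. finite F \<Longrightarrow> (\<Sum>k\<in>F. (1 + (of_int k)\<^sup>2) * (u k)\<^sup>2) \<le> C"
  shows "u \<in> form_dom"
  unfolding form_dom_def mem_Collect_eq
  by (rule nonneg_bdd_above_summable_on) (auto simp: bdd_above_def intro!: exI[of _ C] assms)

lemma form_dom_pointwise_bound:
  assumes "u \<in> form_dom" "mass u + energy u \<le> C"
  shows "(u k)\<^sup>2 \<le> C / (1 + (of_int k)\<^sup>2)"
proof -
  have "(\<Sum>k\<in>{k}. (1 + (of_int k)\<^sup>2) * (u k)\<^sup>2) \<le> mass u + energy u"
    unfolding mass_add_energy[OF assms(1)]
    by (rule finite_sum_le_infsum) (use assms in \<open>auto simp: form_dom_def\<close>)
  with assms(2) show ?thesis
    by (simp add: field_simps add_pos_nonneg)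
qed

text \<open>Split u(k) as w^(-1/2) times w^(1/2) u(k) with w = 1 + k^2 and bound the product by
  squares. This is the embedding of H^1 into absolutely convergent Fourier series.\<close>

lemma form_dom_abs_summable:
  assumes "u \<in> form_dom"
  shows "(\<lambda>k. norm (u k)) summable_on UNIV"
proof -
  have "(\<lambda>k. (1 / (1 + (of_int k)\<^sup>2) + (1 + (of_int k)\<^sup>2) * (u k)\<^sup>2) :: real) summable_on UNIV"
    using assms by (intro summable_on_add summable_on_int_weight) (simp add: form_dom_def)
  then show ?thesis
  proof (rule Infinite_Sum.abs_summable_on_comparison_test')
    fix k :: int
    let ?w = "1 + (of_int k)\<^sup>2 :: real"
    have w: "?w > 0" by (simp add: add_pos_nonneg)
    have "\<bar>sqrt (1 / ?w) * (sqrt ?w * u k)\<bar> \<le> ((sqrt (1 / ?w))\<^sup>2 + (sqrt ?w * u k)\<^sup>2) / 2"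
      by (rule abs_mult_le_mean_squares)
    also have "sqrt (1 / ?w) * (sqrt ?w * u k) = u k"
      using w by (simp add: real_sqrt_divide)
    also have "(sqrt (1 / ?w))\<^sup>2 = 1 / ?w" using w by simp
    also have "(sqrt ?w * u k)\<^sup>2 = ?w * (u k)\<^sup>2" using w by (simp add: power_mult_distrib)
    also have "(1 / ?w + ?w * (u k)\<^sup>2) / 2 \<le> 1 / ?w + ?w * (u k)\<^sup>2"
      using w by (simp add: field_simps)
    finally show "norm (u k) \<le> 1 / ?w + ?w * (u k)\<^sup>2" by simp
  qed
qed

text \<open>On a sublevel set all the series are dominated by C/(1+k^2), whence sequential compactness
  for the topology of pointwise convergence, in which mass and hop are continuous.\<close>
lemma form_dom_compactness:
  assumes U: "\<And>n. U n \<in> form_dom" and C: "\<And>n. mass (U n) + energy (U n) \<le> C"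
  obtains u r where "u \<in> form_dom" "strict_mono (r :: nat \<Rightarrow> nat)"
    "\<And>k. (\<lambda>n. U (r n) k) \<longlonglongrightarrow> u k"
    "(\<lambda>n. mass (U (r n))) \<longlonglongrightarrow> mass u" "(\<lambda>n. hop (U (r n))) \<longlonglongrightarrow> hop u"
proof -
  have C0: "0 \<le> C"
    using C[of 0] mass_nonneg[of "U 0"] energy_nonneg[of "U 0"] by linarith
  have sq: "(U n k)\<^sup>2 \<le> C / (1 + (of_int k)\<^sup>2)" for n k
    using form_dom_pointwise_bound[OF U C] .
  have "C / (1 + (of_int k)\<^sup>2) \<le> C" for k
    using C0 by (simp add: field_simps add_pos_nonneg)
  then have "(U n k)\<^sup>2 \<le> C" for n k
    using sq order_trans by blast
  then have in_box: "U n k \<in> {- sqrt C..sqrt C}" for n k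
    using abs_le_square_iff[of "U n k" "sqrt C"] C0 by (auto simp: abs_le_iff)
  \<comment> \<open>Tychonoff for a box containing all the sequences; with countably many
    coordinates compactness gives convergent subsequences.\<close>
  have "compactin (product_topology (\<lambda>_::int. euclidean) UNIV) (PiE UNIV (\<lambda>_. {- sqrt C..sqrt C}))"
    by (subst compactin_PiE) simp
  then have "compact (PiE UNIV (\<lambda>_::int. {- sqrt C..sqrt C}))"
    by (simp add: euclidean_product_topology)
  then have "seq_compact (PiE UNIV (\<lambda>_::int. {- sqrt C..sqrt C}))"
    by (rule compact_imp_seq_compact)
  then obtain u r where r: "strict_mono (r :: nat \<Rightarrow> nat)" and lim: "(U \<circ> r) \<longlonglongrightarrow> u"
    using in_box unfolding seq_compact_def by (metis PiE_UNIV_domain UNIV_I Pi_I)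
  have pw: "(\<lambda>n. U (r n) k) \<longlonglongrightarrow> u k" for k
    using continuous_on_tendsto_compose[OF continuous_on_product_coordinates[of k] lim] by (simp add: o_def)
  have "u \<in> form_dom"
  proof (rule form_dom_boundI)
    fix F :: "int set" assume F: "finite F"
    have "(\<lambda>n. \<Sum>k\<in>F. (1 + (of_int k)\<^sup>2) * (U (r n) k)\<^sup>2) \<longlonglongrightarrow> (\<Sum>k\<in>F. (1 + (of_int k)\<^sup>2) * (u k)\<^sup>2)"
      by (intro tendsto_intros pw)
    moreover have "(\<Sum>k\<in>F. (1 + (of_int k)\<^sup>2) * (U (r n) k)\<^sup>2) \<le> C" for n
      using finite_sum_le_infsum[of "\<lambda>k. (1 + (of_int k)\<^sup>2) * (U (r n) k)\<^sup>2" UNIV F] F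
        U[of "r n"] C[of "r n"] mass_add_energy[OF U]
      by (simp add: form_dom_def)
    ultimately show "(\<Sum>k\<in>F. (1 + (of_int k)\<^sup>2) * (u k)\<^sup>2) \<le> C"
      by (intro LIMSEQ_le_const2) auto
  qed
  define w where "w k = C / (1 + (of_int k)\<^sup>2)" for k :: int
  have w: "w summable_on UNIV"
    using summable_on_cmult_right[OF summable_on_int_weight, of C] by (simp add: w_def[abs_def])
  have w2: "(\<lambda>k. (w k + w (k + 1)) / 2) summable_on UNIV"
    using summable_on_cmult_left[OF summable_on_add[OF w summable_on_shift_int(1)[THEN iffD2, OF w]], of 1 "1/2"]
    by simp
  have "(\<lambda>n. mass (U (r n))) \<longlonglongrightarrow> mass u"
    unfolding mass_def
    by (rule infsum_dominated_convergence(2)[OF _ _ w]) (use sq in \<open>auto intro!: tendsto_intros pw simp: w_def\<close>)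
  moreover have "(\<lambda>n. hop (U (r n))) \<longlonglongrightarrow> hop u"
    unfolding hop_def
  proof (rule infsum_dominated_convergence(2)[OF _ _ w2])
    show "norm (U (r n) k * U (r n) (k + 1)) \<le> (w k + w (k + 1)) / 2" for n k
      using abs_mult_le_mean_squares[of "U (r n) k" "U (r n) (k + 1)"] sq[of "r n" k] sq[of "r n" "k + 1"]
      by (simp add: w_def)
  qed (intro tendsto_intros pw)
  ultimately show ?thesis
    using that \<open>u \<in> form_dom\<close> r pw by blast
qed

subsection \<open>Variational problems on sequences\<close>

text \<open>The quadratic form of 1 - cos Q + s P^2. The value s = 0 gives the bare error, so one
  existence lemma serves the constrained and the penalized problem.\<close>

definition form :: "real \<Rightarrow> (int \<Rightarrow> real) \<Rightarrow> real" where
  "form s u = mass u - hop u + s * energy u"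

definition ground :: "real \<Rightarrow> real" where
  "ground s = Inf (form s ` {v \<in> form_dom. mass v = 1})"

definition min_error :: "real \<Rightarrow> real" where
  "min_error E = Inf ((\<lambda>v. 1 - hop v) ` {v \<in> form_dom. mass v = 1 \<and> energy v \<le> E})"

text \<open>The eigenvalue equation of 1 - cos Q + s P^2 in coefficients: diagonal 1 + s k^2,
  off-diagonal -1/2. Membership in \<open>form_dom\<close> selects the decaying solutions of this
  second-order recurrence.\<close>

definition eigenseq :: "real \<Rightarrow> real \<Rightarrow> (int \<Rightarrow> real) \<Rightarrow> bool" where
  "eigenseq s l u \<longleftrightarrow> u \<in> form_dom \<and>
     (\<forall>k. s * (of_int k)\<^sup>2 * u k + (1 - l) * u k = (u (k + 1) + u (k - 1)) / 2)"

lemma infsum_single: "(\<Sum>\<^sub>\<infinity>k. if k = j then c else 0) = (c :: real)"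
  and summable_on_single: "(\<lambda>k. if k = j then c else (0::real)) summable_on UNIV"
proof -
  have "((\<lambda>k. if k = j then c else 0) has_sum c) UNIV"
    by (rule has_sum_finite_neutralI[where B = "{j}"]) auto
  then show "(\<Sum>\<^sub>\<infinity>k. if k = j then c else 0) = c" "(\<lambda>k. if k = j then c else 0) summable_on UNIV"
    by (auto simp: has_sum_iff)
qed

lemma mass_delta: "mass (\<lambda>k. if k = j then c else 0) = c\<^sup>2"
proof -
  have "mass (\<lambda>k. if k = j then c else 0) = (\<Sum>\<^sub>\<infinity>k. if k = j then c\<^sup>2 else 0)"
    unfolding mass_def by (rule infsum_cong) auto
  then show ?thesis by (simp only: infsum_single)
qed

lemma energy_delta: "energy (\<lambda>k. if k = j then c else 0) = (of_int j)\<^sup>2 * c\<^sup>2"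
proof -
  have "energy (\<lambda>k. if k = j then c else 0) = (\<Sum>\<^sub>\<infinity>k. if k = j then (of_int j)\<^sup>2 * c\<^sup>2 else 0)"
    unfolding energy_def by (rule infsum_cong) auto
  then show ?thesis by (simp only: infsum_single)
qed

lemma hop_delta: "hop (\<lambda>k. if k = j then c else 0) = 0"
  unfolding hop_def by (rule infsum_0) auto

lemma delta_in_form_dom: "(\<lambda>k. if k = j then c else 0) \<in> form_dom"
  by (rule form_dom_finite_support[of "{j}"]) auto

text \<open>A Fatou argument: energy is only lower semicontinuous under pointwise convergence, but
  finite partial sums pass to the limit. The factor \<open>s\<close> lets it serve both the
  constraint and the energy term of \<open>form\<close>.\<close>

lemma energy_le_limit:
  assumes U: "\<And>n. U n \<in> form_dom" and pw: "\<And>k. (\<lambda>n. U n k) \<longlonglongrightarrow> u k" and u: "u \<in> form_dom"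
    and s: "s \<ge> 0" and b: "\<And>n. s * energy (U n) \<le> b n" "b \<longlonglongrightarrow> B"
  shows "s * energy u \<le> B"
proof -
  have "(\<Sum>\<^sub>\<infinity>k. s * ((of_int k)\<^sup>2 * (u k)\<^sup>2)) \<le> B"
  proof (rule infsum_le_finite_sums)
    show "(\<lambda>k. s * ((of_int k)\<^sup>2 * (u k)\<^sup>2)) summable_on UNIV"
      using form_domD(2)[OF u] by (rule summable_on_cmult_right)
    fix F :: "int set" assume F: "finite F" "F \<subseteq> UNIV"
    have "(\<lambda>n. \<Sum>k\<in>F. s * ((of_int k)\<^sup>2 * (U n k)\<^sup>2)) \<longlonglongrightarrow> (\<Sum>k\<in>F. s * ((of_int k)\<^sup>2 * (u k)\<^sup>2))"
      by (intro tendsto_intros pw)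
    moreover have "(\<Sum>k\<in>F. s * ((of_int k)\<^sup>2 * (U n k)\<^sup>2)) \<le> b n" for n
    proof -
      have "(\<Sum>k\<in>F. s * ((of_int k)\<^sup>2 * (U n k)\<^sup>2)) = s * (\<Sum>k\<in>F. (of_int k)\<^sup>2 * (U n k)\<^sup>2)"
        by (simp add: sum_distrib_left)
      also have "\<dots> \<le> s * energy (U n)"
        unfolding energy_def
        by (intro mult_left_mono finite_sum_le_infsum form_domD(2)[OF U] F s) auto
      finally show ?thesis using b(1)[of n] by linarith
    qed
    ultimately show "(\<Sum>k\<in>F. s * ((of_int k)\<^sup>2 * (u k)\<^sup>2)) \<le> B"
      using b(2) by (intro LIMSEQ_le) auto
  qed
  then show ?thesis
    by (simp add: energy_def infsum_cmult_right')
qed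

text \<open>The direct method: the energy bound makes a minimizing sequence precompact, mass and hop
  converge, and energy does not jump up in the limit.\<close>

lemma constrained_minimizer:
  assumes s: "s \<ge> 0" and C: "C \<ge> 0"
  obtains u where "u \<in> form_dom" "mass u = 1" "energy u \<le> C"
    "\<And>v. v \<in> form_dom \<Longrightarrow> mass v = 1 \<Longrightarrow> energy v \<le> C \<Longrightarrow> form s u \<le> form s v"
proof -
  define S where "S = {v \<in> form_dom. mass v = 1 \<and> energy v \<le> C}"
  define m where "m = Inf (form s ` S)"
  have "(\<lambda>k. if k = 0 then 1 else 0) \<in> S"
    using C by (auto simp: S_def mass_delta energy_delta delta_in_form_dom)
  then have ne: "form s ` S \<noteq> {}" by auto
  have bdd: "bdd_below (form s ` S)"
    unfolding bdd_below_def
  proof (intro exI[of _ 0] ballI)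
    fix x assume "x \<in> form s ` S"
    then obtain v where "v \<in> form_dom" "x = form s v" by (auto simp: S_def)
    then show "0 \<le> x"
      using hop_le_mass[of v] energy_nonneg[of v] s by (simp add: form_def)
  qed
  have "\<exists>v\<in>S. form s v < m + 1 / real (Suc n)" for n
    using cInf_lessD[OF ne, of "m + 1 / real (Suc n)"] by (auto simp: m_def)
  then obtain U where U: "U n \<in> S" and Um: "form s (U n) < m + 1 / real (Suc n)" for n
    by metis
  have "mass (U n) + energy (U n) \<le> 1 + C" and UD: "U n \<in> form_dom" for n
    using U[of n] by (auto simp: S_def)
  then obtain u r where u: "u \<in> form_dom" and r: "strict_mono (r :: nat \<Rightarrow> nat)"
    and pw: "\<And>k. (\<lambda>n. U (r n) k) \<longlonglongrightarrow> u k"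
    and ms: "(\<lambda>n. mass (U (r n))) \<longlonglongrightarrow> mass u" and hp: "(\<lambda>n. hop (U (r n))) \<longlonglongrightarrow> hop u"
    using form_dom_compactness[of U "1 + C"] by blast
  have m1: "mass (U n) = 1" for n
    using U[of n] by (simp add: S_def)
  then have mu: "mass u = 1"
    using ms by (simp add: LIMSEQ_const_iff)
  have "1 * energy u \<le> C"
    by (rule energy_le_limit[OF UD pw u, where b = "\<lambda>n. C"]) (use U in \<open>auto simp: S_def\<close>)
  \<comment> \<open>As the mass is 1, this is form s u \<le> m rearranged, with the convergent hop
    on the right. The summand 0 is the limit of the tolerance 1 / (n + 1).\<close>
  moreover have "s * energy u \<le> (m + 0) - 1 + hop u"
  proof (rule energy_le_limit[OF UD pw u s])
    show "s * energy (U (r n)) \<le> (m + 1 / real (Suc (r n))) - 1 + hop (U (r n))" for n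
      using Um[of "r n"] m1[of "r n"] by (simp add: form_def)
    have "(\<lambda>n. 1 / real (Suc (r n))) \<longlonglongrightarrow> 0"
      using LIMSEQ_subseq_LIMSEQ[OF LIMSEQ_Suc[OF lim_1_over_n] r] by (simp add: o_def)
    then show "(\<lambda>n. (m + 1 / real (Suc (r n))) - 1 + hop (U (r n))) \<longlonglongrightarrow> (m + 0) - 1 + hop u"
      by (intro tendsto_intros hp)
  qed
  moreover have "m \<le> form s v" if "v \<in> form_dom" "mass v = 1" "energy v \<le> C" for v
    unfolding m_def using that by (intro cInf_lower[OF _ bdd]) (auto simp: S_def)
  ultimately show ?thesis
    using u mu by (intro that[of u]) (fastforce simp: form_def)+
qed

lemma form_scale: "form s (\<lambda>k. t * u k) = t\<^sup>2 * form s u"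
  by (simp add: form_def mass_scale hop_scale energy_scale algebra_simps)

lemma mass_eq_0D:
  assumes "u \<in> form_dom" "mass u = 0"
  shows "u = (\<lambda>_. 0)"
proof
  fix k
  have "(u k)\<^sup>2 = 0"
    using assms form_domD(1)[OF assms(1)] unfolding mass_def
    by (intro nonneg_infsum_le_0D[of "\<lambda>k. (u k)\<^sup>2" UNIV]) auto
  then show "u k = 0" by simp
qed

text \<open>Compactness needs an energy bound that the penalized problem does not state. The cutoff
  1/s is the energy from which the penalty alone reaches the value of the trial sequence at
  0.\<close>

lemma ground_attained:
  assumes s: "s > 0"
  obtains u where "u \<in> form_dom" "mass u = 1" "form s u = ground s"
    and "\<And>v. v \<in> form_dom \<Longrightarrow> ground s * mass v \<le> form s v"
proof -
  have "1 / s \<ge> 0" using s by simp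
  from constrained_minimizer[OF less_imp_le[OF s] this]
  obtain u where u: "u \<in> form_dom" "mass u = 1"
    and min: "\<And>v. v \<in> form_dom \<Longrightarrow> mass v = 1 \<Longrightarrow> energy v \<le> 1 / s \<Longrightarrow> form s u \<le> form s v"
    by blast
  have "form s u \<le> form s (\<lambda>k. if k = 0 then 1 else 0)"
    by (rule min) (use s in \<open>auto simp: mass_delta energy_delta delta_in_form_dom\<close>)
  then have "form s u \<le> 1"
    by (simp add: form_def mass_delta energy_delta hop_delta)
  \<comment> \<open>Beyond energy 1/s the form already exceeds its value 1 at the unit sequence supported at 0.\<close>
  moreover have "1 \<le> form s v" if "v \<in> form_dom" "energy v > 1 / s" for v
    using hop_le_mass[OF that(1)] that(2) s by (simp add: form_def field_simps)
  ultimately have min': "form s u \<le> form s v" if "v \<in> form_dom" "mass v = 1" for v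
    using min[OF that] that by (meson le_less_linear order_trans)
  then have gr: "form s u = ground s"
    unfolding ground_def using u by (intro cInf_eq_minimum[symmetric]) auto
  \<comment> \<open>Both sides are homogeneous of degree 2, so normalization gives all v of nonzero
    mass.\<close>
  have "ground s * mass v \<le> form s v" if v: "v \<in> form_dom" for v
  proof (cases "mass v = 0")
    case True
    have "s * energy v \<ge> 0" using s energy_nonneg[of v] by simp
    then show ?thesis
      using True hop_le_mass[OF v] by (simp add: form_def)
  next
    case False
    then have mv: "mass v > 0" using mass_nonneg[of v] by simp
    define c where "c = 1 / sqrt (mass v)"
    have c2: "c\<^sup>2 = 1 / mass v" using mv by (simp add: c_def power_divide)
    have "form s u \<le> form s (\<lambda>k. c * v k)"
      by (rule min'[OF form_dom_scale[OF v]]) (use mv in \<open>simp add: mass_scale c2\<close>)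
    then show ?thesis
      using mv by (simp add: form_scale c2 gr field_simps)
  qed
  with u gr show ?thesis using that by blast
qed

lemma ground_le_form: "s > 0 \<Longrightarrow> v \<in> form_dom \<Longrightarrow> ground s * mass v \<le> form s v"
  by (rule ground_attained[of s]) auto

text \<open>Multiply the recurrence by u(k) and sum; after an index shift both neighbour sums equal
  \<open>hop u\<close>.\<close>

lemma eigenseq_form:
  assumes "eigenseq s l u"
  shows "form s u = l * mass u"
proof -
  have u: "u \<in> form_dom" and rec: "\<And>k. s * (of_int k)\<^sup>2 * u k + (1 - l) * u k = (u (k + 1) + u (k - 1)) / 2"
    using assms by (auto simp: eigenseq_def)
  have h1: "(\<lambda>k. u k * u (k + 1)) summable_on UNIV"
    by (rule form_dom_hop_summable[OF u])
  have h2: "(\<lambda>k. u k * u (k - 1)) summable_on UNIV" "(\<Sum>\<^sub>\<infinity>k. u k * u (k - 1)) = hop u"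
    using h1 summable_on_shift_int[of "\<lambda>k. u k * u (k + 1)" "-1"] by (simp_all add: hop_def mult.commute)
  have "s * energy u + (1 - l) * mass u
      = (\<Sum>\<^sub>\<infinity>k. s * ((of_int k)\<^sup>2 * (u k)\<^sup>2)) + (\<Sum>\<^sub>\<infinity>k. (1 - l) * (u k)\<^sup>2)"
    by (simp only: energy_def mass_def infsum_cmult_right')
  also have "\<dots> = (\<Sum>\<^sub>\<infinity>k. s * ((of_int k)\<^sup>2 * (u k)\<^sup>2) + (1 - l) * (u k)\<^sup>2)"
    by (rule infsum_add[symmetric]) (intro summable_on_cmult_right form_domD[OF u])+
  also have "\<dots> = (\<Sum>\<^sub>\<infinity>k. (u k * u (k + 1) + u k * u (k - 1)) * (1/2))"
  proof (rule infsum_cong)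
    fix k
    have "s * ((of_int k)\<^sup>2 * (u k)\<^sup>2) + (1 - l) * (u k)\<^sup>2 = u k * (s * (of_int k)\<^sup>2 * u k + (1 - l) * u k)"
      by (simp add: power2_eq_square algebra_simps)
    then show "s * ((of_int k)\<^sup>2 * (u k)\<^sup>2) + (1 - l) * (u k)\<^sup>2 = (u k * u (k + 1) + u k * u (k - 1)) * (1/2)"
      unfolding rec by (simp add: algebra_simps)
  qed
  also have "\<dots> = hop u"
    by (simp only: infsum_cmult_left' infsum_add[OF h1 h2(1)] h2(2)) (simp add: hop_def)
  finally show ?thesis
    by (simp add: form_def algebra_simps)
qed

text \<open>Variations of a single coordinate suffice for the Euler-Lagrange equation: stationarity
  in coordinate j is exactly the recurrence at j.\<close>

lemma mass_add_delta:
  assumes "u \<in> form_dom"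
  shows "mass (\<lambda>k. u k + (if k = j then t else 0)) = mass u + (2 * t * u j + t\<^sup>2)"
proof -
  have "mass (\<lambda>k. u k + (if k = j then t else 0)) = (\<Sum>\<^sub>\<infinity>k. (u k)\<^sup>2 + (if k = j then 2 * t * u j + t\<^sup>2 else 0))"
    unfolding mass_def by (rule infsum_cong) (auto simp: power2_sum)
  then show ?thesis
    by (simp add: infsum_add form_domD[OF assms] summable_on_single infsum_single mass_def)
qed

lemma energy_add_delta:
  assumes "u \<in> form_dom"
  shows "energy (\<lambda>k. u k + (if k = j then t else 0)) = energy u + (of_int j)\<^sup>2 * (2 * t * u j + t\<^sup>2)"
proof -
  have "energy (\<lambda>k. u k + (if k = j then t else 0))
      = (\<Sum>\<^sub>\<infinity>k. (of_int k)\<^sup>2 * (u k)\<^sup>2 + (if k = j then (of_int j)\<^sup>2 * (2 * t * u j + t\<^sup>2) else 0))"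
    unfolding energy_def by (rule infsum_cong) (auto simp: power2_sum algebra_simps)
  then show ?thesis
    by (simp add: infsum_add form_domD[OF assms] summable_on_single infsum_single energy_def)
qed

lemma hop_add_delta:
  assumes "u \<in> form_dom"
  shows "hop (\<lambda>k. u k + (if k = j then t else 0)) = hop u + t * (u (j + 1) + u (j - 1))"
proof -
  have "hop (\<lambda>k. u k + (if k = j then t else 0))
      = (\<Sum>\<^sub>\<infinity>k. u k * u (k + 1) + ((if k = j then t * u (j + 1) else 0) + (if k = j - 1 then t * u (j - 1) else 0)))"
    unfolding hop_def by (rule infsum_cong) (auto simp: algebra_simps)
  then show ?thesis
    by (simp only: infsum_add form_dom_hop_summable[OF assms] summable_on_single summable_on_add infsum_single
        hop_def[symmetric]) (simp add: algebra_simps)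
qed

lemma linear_coeff_zero:
  fixes b c :: real
  assumes "\<And>t. 0 \<le> t * b + t\<^sup>2 * c"
  shows "b = 0"
proof (rule ccontr)
  assume "b \<noteq> 0"
  \<comment> \<open>At t = -b/d the expression equals b^2 (c - d) / d^2, which is negative as soon
    as d exceeds c.\<close>
  define d where "d = 1 + \<bar>c\<bar>"
  have d: "d > 0" "c < d" by (auto simp: d_def)
  have "0 \<le> (- b / d) * b + (- b / d)\<^sup>2 * c" by (rule assms)
  also have "\<dots> = b\<^sup>2 / d\<^sup>2 * (c - d)"
    using d by (simp add: field_simps power2_eq_square)
  also have "\<dots> < 0"
    using d \<open>b \<noteq> 0\<close> by (intro mult_pos_neg) auto
  finally show False by simp
qed

text \<open>The nonnegative form \<open>form s v - ground s * mass v\<close> vanishes at u, hence is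
  minimal there, and its first variation is zero in every coordinate.\<close>

lemma ground_state_eigenseq:
  assumes s: "s > 0" and u: "u \<in> form_dom" and eq: "form s u = ground s * mass u"
  shows "eigenseq s (ground s) u"
  unfolding eigenseq_def
proof (intro conjI allI u)
  fix j
  define c where "c = 1 - ground s + s * (of_int j)\<^sup>2"
  have "0 \<le> t * (2 * c * u j - (u (j + 1) + u (j - 1))) + t\<^sup>2 * c" for t
  proof -
    define v where "v = (\<lambda>k. u k + (if k = j then t else 0))"
    have "v \<in> form_dom"
      unfolding v_def by (rule form_dom_add[OF u delta_in_form_dom])
    from ground_le_form[OF s this] have "0 \<le> form s v - ground s * mass v" by simp
    also have "\<dots> = (form s u - ground s * mass u) + (t * (2 * c * u j - (u (j + 1) + u (j - 1))) + t\<^sup>2 * c)"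
      by (simp add: form_def v_def mass_add_delta hop_add_delta energy_add_delta u c_def algebra_simps)
    finally show ?thesis using eq by simp
  qed
  then have "2 * c * u j - (u (j + 1) + u (j - 1)) = 0"
    by (rule linear_coeff_zero)
  then show "s * (of_int j)\<^sup>2 * u j + (1 - ground s) * u j = (u (j + 1) + u (j - 1)) / 2"
    by (simp add: c_def algebra_simps)
qed

lemma eigenseq_diff_scale:
  assumes "eigenseq s l u" "eigenseq s l v"
  shows "eigenseq s l (\<lambda>k. u k - t * v k)"
proof -
  have "(\<lambda>k. u k + (- t) * v k) \<in> form_dom"
    using assms by (intro form_dom_add form_dom_scale) (auto simp: eigenseq_def)
  moreover have "s * (of_int k)\<^sup>2 * (u k - t * v k) + (1 - l) * (u k - t * v k)
      = ((u (k + 1) - t * v (k + 1)) + (u (k - 1) - t * v (k - 1))) / 2" for k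
  proof -
    have "s * (of_int k)\<^sup>2 * (u k - t * v k) + (1 - l) * (u k - t * v k)
        = (s * (of_int k)\<^sup>2 * u k + (1 - l) * u k) - t * (s * (of_int k)\<^sup>2 * v k + (1 - l) * v k)"
      by (simp add: algebra_simps)
    also have "\<dots> = (u (k + 1) + u (k - 1)) / 2 - t * ((v (k + 1) + v (k - 1)) / 2)"
      using assms by (simp only: eigenseq_def)
    finally show ?thesis by (simp add: field_simps)
  qed
  ultimately show ?thesis by (simp add: eigenseq_def)
qed

text \<open>The absolute value of a ground state is again a ground state, so a zero of a ground state
  forces its two neighbours to vanish as well and propagates everywhere.\<close>
lemma ground_state_zero:
  assumes s: "s > 0" and u: "eigenseq s (ground s) u" and "u 0 = 0"
  shows "u = (\<lambda>_. 0)"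
proof -
  have uD: "u \<in> form_dom" using u by (simp add: eigenseq_def)
  let ?a = "\<lambda>k. \<bar>u k\<bar>"
  have "form s ?a \<le> form s u"
    using hop_le_hop_abs[OF uD] by (simp add: form_def)
  then have "form s ?a = ground s * mass ?a"
    using ground_le_form[OF s form_dom_abs[OF uD]] eigenseq_form[OF u] by simp
  then have a: "eigenseq s (ground s) ?a"
    by (rule ground_state_eigenseq[OF s form_dom_abs[OF uD]])
  have step: "u (k + 1) = 0 \<and> u (k - 1) = 0" if "u k = 0" for k
  proof -
    have "s * (of_int k)\<^sup>2 * ?a k + (1 - ground s) * ?a k = (?a (k + 1) + ?a (k - 1)) / 2"
      using a unfolding eigenseq_def by blast
    with that have "\<bar>u (k + 1)\<bar> + \<bar>u (k - 1)\<bar> = 0" by simp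
    then show ?thesis by linarith
  qed
  show ?thesis
  proof
    fix k show "u k = 0"
    proof (induction k rule: int_induct[where k = 0])
      case base show ?case by fact
    next
      case (step1 i) then show ?case using step[of i] by blast
    next
      case (step2 i) then show ?case using step[of i] by blast
    qed
  qed
qed

text \<open>Subtract the multiple of u that cancels v at index 0; a ground state with a zero is
  identically zero.\<close>

lemma ground_state_unique:
  assumes s: "s > 0" and u: "eigenseq s (ground s) u" "mass u \<noteq> 0" and v: "eigenseq s (ground s) v"
  obtains t where "v = (\<lambda>k. t * u k)"
proof -
  have u0: "u 0 \<noteq> 0"
    using ground_state_zero[OF s u(1)] u(2) by (auto simp: mass_def)
  have "eigenseq s (ground s) (\<lambda>k. v k - v 0 / u 0 * u k)"
    by (rule eigenseq_diff_scale[OF v u(1)])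
  from ground_state_zero[OF s this] have "(\<lambda>k. v k - v 0 / u 0 * u k) = (\<lambda>_. 0)"
    using u0 by simp
  then have "v k = v 0 / u 0 * u k" for k
    using fun_cong[of _ _ k] by fastforce
  then show ?thesis by (intro that ext)
qed

text \<open>The recurrence is invariant under reflection, and u minus its reflection vanishes at 0.
  This places the optimal wave function among the even ones.\<close>

lemma ground_state_even:
  assumes s: "s > 0" and u: "eigenseq s (ground s) u"
  shows "u (- k) = u k"
proof -
  have "eigenseq s (ground s) (\<lambda>k. u (- k))"
    unfolding eigenseq_def
  proof (intro conjI allI)
    show "(\<lambda>k. u (- k)) \<in> form_dom"
      using u by (intro form_dom_uminus) (simp add: eigenseq_def)
    fix k
    have "s * (of_int (- k))\<^sup>2 * u (- k) + (1 - ground s) * u (- k) = (u (- k + 1) + u (- k - 1)) / 2"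
      using u by (simp only: eigenseq_def)
    moreover have "- (k + 1) = - k - 1" "- (k - 1) = - k + 1" by simp_all
    ultimately show "s * (of_int k)\<^sup>2 * u (- k) + (1 - ground s) * u (- k) = (u (- (k + 1)) + u (- (k - 1))) / 2"
      by (simp only: of_int_minus power2_minus add.commute)
  qed
  from ground_state_zero[OF s eigenseq_diff_scale[OF this u, of 1]]
  have "(\<lambda>k. u (- k) - 1 * u k) = (\<lambda>_. 0)" by simp
  from fun_cong[OF this, of k] show ?thesis by simp
qed

subsection \<open>Strong duality\<close>

lemma min_error_attained:
  assumes "E \<ge> 0"
  obtains u where "u \<in> form_dom" "mass u = 1" "energy u \<le> E" "1 - hop u = min_error E"
    and "\<And>v. v \<in> form_dom \<Longrightarrow> mass v = 1 \<Longrightarrow> energy v \<le> E \<Longrightarrow> min_error E \<le> 1 - hop v"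
proof -
  obtain u where u: "u \<in> form_dom" "mass u = 1" "energy u \<le> E"
    and min: "\<And>v. v \<in> form_dom \<Longrightarrow> mass v = 1 \<Longrightarrow> energy v \<le> E \<Longrightarrow> form 0 u \<le> form 0 v"
    using constrained_minimizer[OF order_refl assms] by blast
  have eq: "1 - hop u = min_error E"
    unfolding min_error_def using u min
    by (intro cInf_eq_minimum[symmetric]) (auto simp: form_def)
  show ?thesis
  proof (rule that[OF u eq])
    show "min_error E \<le> 1 - hop v" if "v \<in> form_dom" "mass v = 1" "energy v \<le> E" for v
      using min[OF that] u(2) that(2) eq by (simp add: form_def)
  qed
qed

lemma min_error_le:
  "v \<in> form_dom \<Longrightarrow> mass v = 1 \<Longrightarrow> energy v \<le> E \<Longrightarrow> min_error E \<le> 1 - hop v"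
  by (rule min_error_attained[of E]) (use energy_nonneg[of v] in auto)

text \<open>The right-hand side is the sum of all squared differences of neighbours, of which the
  left is one term.\<close>

lemma square_diff_le:
  assumes "u \<in> form_dom"
  shows "(u j - u (j + 1))\<^sup>2 \<le> 2 * (mass u - hop u)"
proof -
  have s: "(\<lambda>k. (u k)\<^sup>2) summable_on UNIV" "(\<lambda>k. (u (k+1))\<^sup>2) summable_on UNIV"
    "(\<lambda>k. (- 2) * (u k * u (k + 1))) summable_on UNIV"
    using form_domD(1)[OF assms] summable_on_shift_int(1)[of "\<lambda>k. (u k)\<^sup>2" 1]
      summable_on_cmult_right[OF form_dom_hop_summable[OF assms], of "- 2"] by auto
  have eq: "(u k - u (k + 1))\<^sup>2 = (u k)\<^sup>2 + (u (k+1))\<^sup>2 + (- 2) * (u k * u (k + 1))" for k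
    by (simp add: power2_diff)
  have "(\<Sum>k\<in>{j}. (u k - u (k + 1))\<^sup>2) \<le> (\<Sum>\<^sub>\<infinity>k. (u k - u (k + 1))\<^sup>2)"
  proof (rule finite_sum_le_infsum)
    show "(\<lambda>k. (u k - u (k + 1))\<^sup>2) summable_on UNIV"
      unfolding eq by (intro summable_on_add s)
  qed auto
  also have "\<dots> = mass u + mass u + (- 2) * hop u"
    unfolding eq
    by (subst infsum_add[OF summable_on_add[OF s(1,2)] s(3)], subst infsum_add[OF s(1,2)])
       (simp only: mass_def hop_def infsum_cmult_right' summable_on_shift_int(2)[of "\<lambda>k. (u k)\<^sup>2"])
  finally show ?thesis by simp
qed

text \<open>Equality would make all neighbours equal. A constant nonzero sequence contradicts the
  decay C / (1 + n^2) once n exceeds C / u(0)^2, since n \<le> 1 + n^2.\<close>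

lemma hop_less_mass:
  assumes u: "u \<in> form_dom" and "mass u \<noteq> 0"
  shows "hop u < mass u"
proof (rule ccontr)
  assume "\<not> hop u < mass u"
  then have "(u k - u (k + 1))\<^sup>2 \<le> 0" for k
    by (intro order_trans[OF square_diff_le[OF u]]) simp
  then have step: "u (k + 1) = u k" for k by simp
  have const: "u k = u 0" for k
  proof (induction k rule: int_induct[where k = 0])
    case base show ?case by simp
  next
    case (step1 i) then show ?case using step[of i] by metis
  next
    case (step2 i) then show ?case using step[of "i - 1"] by (metis diff_add_cancel)
  qed
  define C where "C = mass u + energy u"
  have "(u 0)\<^sup>2 = 0"
  proof (rule ccontr)
    assume nz: "(u 0)\<^sup>2 \<noteq> 0"
    obtain n :: nat where n: "C / (u 0)\<^sup>2 < real n"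
      using reals_Archimedean2 by blast
    have "C < real n * (u 0)\<^sup>2"
      using n nz by (simp add: field_simps)
    also have "real n \<le> 1 + (real n)\<^sup>2"
      using sum_squares_bound[of "real n" 1] by (simp add: power2_eq_square)
    then have "real n * (u 0)\<^sup>2 \<le> (1 + (real n)\<^sup>2) * (u 0)\<^sup>2"
      by (intro mult_right_mono) auto
    also have "(u 0)\<^sup>2 \<le> C / (1 + (real n)\<^sup>2)"
      using form_dom_pointwise_bound[OF u, of C "int n"] const[of "int n"] by (simp add: C_def)
    then have "(1 + (real n)\<^sup>2) * (u 0)\<^sup>2 \<le> C"
      by (simp add: field_simps add_pos_nonneg)
    finally show False by simp
  qed
  then have "u = (\<lambda>_. 0)" using const by fastforce
  then show False using \<open>mass u \<noteq> 0\<close> by (simp add: mass_def)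
qed

lemma min_error_pos:
  assumes "E \<ge> 0"
  shows "min_error E > 0"
proof -
  obtain u where "u \<in> form_dom" "mass u = 1" "1 - hop u = min_error E"
    using min_error_attained[OF assms] by metis
  then show ?thesis using hop_less_mass[of u] by simp
qed

text \<open>Spread the mass evenly over n consecutive sites: they have n - 1 bonds of weight 1/n, so
  only 1/n of the hop is lost.\<close>

lemma min_error_small:
  assumes "n > 0"
  obtains E where "E \<ge> 0" "min_error E \<le> 1 / real n"
proof -
  define c where "c = sqrt (1 / real n)"
  have c2: "c\<^sup>2 = 1 / real n" by (simp add: c_def)
  define u where "u k = (if k \<in> {0..<int n} then c else 0)" for k
  have u: "u \<in> form_dom"
    by (rule form_dom_finite_support[of "{0..<int n}"]) (auto simp: u_def)
  have "mass u = (\<Sum>\<^sub>\<infinity>k\<in>{0..<int n}. c\<^sup>2)"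
    unfolding mass_def by (rule infsum_cong_neutral) (auto simp: u_def)
  then have mu: "mass u = 1"
    using assms by (simp add: c2)
  have "hop u = (\<Sum>\<^sub>\<infinity>k\<in>{0..<int n - 1}. c\<^sup>2)"
    unfolding hop_def by (rule infsum_cong_neutral) (auto simp: u_def power2_eq_square)
  also have "\<dots> = (real n - 1) / real n"
    using assms by (simp add: c2 of_nat_diff)
  finally have "1 - hop u = 1 / real n"
    using assms by (simp add: field_simps)
  then have "min_error (energy u) \<le> 1 / real n"
    using min_error_le[OF u mu order_refl] by simp
  then show ?thesis using that energy_nonneg by blast
qed

lemma cauchy_schwarz_two:
  fixes a b c d :: real
  shows "a * c + b * d \<le> sqrt (a\<^sup>2 + b\<^sup>2) * sqrt (c\<^sup>2 + d\<^sup>2)"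
proof -
  have "0 \<le> (a * d - b * c)\<^sup>2" by simp
  then have "(a * c + b * d)\<^sup>2 \<le> (a\<^sup>2 + b\<^sup>2) * (c\<^sup>2 + d\<^sup>2)"
    by (simp add: power2_eq_square algebra_simps)
  then show ?thesis
    unfolding real_sqrt_mult[symmetric] by (rule real_le_rsqrt)
qed

text \<open>In the variables p = u^2 mass and energy are linear, while hop is concave because
  (p, q) \<mapsto> sqrt (p q) is.\<close>
lemma min_error_convex: "convex_on {0..} min_error"
proof (rule convex_onI)
  fix t x y :: real
  assume t: "0 < t" "t < 1" and "x \<in> {0..}" "y \<in> {0..}"
  then have xy: "x \<ge> 0" "y \<ge> 0" by auto
  obtain u where u: "u \<in> form_dom" "mass u = 1" "energy u \<le> x" "1 - hop u = min_error x"
    using min_error_attained[OF xy(1)] by metis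
  obtain v where v: "v \<in> form_dom" "mass v = 1" "energy v \<le> y" "1 - hop v = min_error y"
    using min_error_attained[OF xy(2)] by metis
  define w where "w k = sqrt ((1 - t) * (u k)\<^sup>2 + t * (v k)\<^sup>2)" for k
  have w2: "(w k)\<^sup>2 = (1 - t) * (u k)\<^sup>2 + t * (v k)\<^sup>2" for k
    using t by (simp add: w_def)
  have wD: "w \<in> form_dom"
    using summable_on_add[OF summable_on_cmult_right[of "\<lambda>k. (1 + (of_int k)\<^sup>2) * (u k)\<^sup>2" UNIV "1 - t"]
        summable_on_cmult_right[of "\<lambda>k. (1 + (of_int k)\<^sup>2) * (v k)\<^sup>2" UNIV t]] u(1) v(1)
    by (simp add: form_dom_def w2 algebra_simps)
  have mw: "mass w = 1"
    unfolding mass_def w2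
    by (subst infsum_add) (use u v form_domD in \<open>auto simp: infsum_cmult_right' mass_def[symmetric] intro!: summable_on_cmult_right\<close>)
  have "energy w = (\<Sum>\<^sub>\<infinity>k. (1 - t) * ((of_int k)\<^sup>2 * (u k)\<^sup>2) + t * ((of_int k)\<^sup>2 * (v k)\<^sup>2))"
    unfolding energy_def w2 by (simp add: algebra_simps)
  also have "\<dots> = (1 - t) * energy u + t * energy v"
    by (subst infsum_add) (use u v form_domD in \<open>auto simp: infsum_cmult_right' energy_def[symmetric] intro!: summable_on_cmult_right\<close>)
  also have "\<dots> \<le> (1 - t) * x + t * y"
    using t u(3) v(3) by (intro add_mono mult_left_mono) auto
  finally have "min_error ((1 - t) * x + t * y) \<le> 1 - hop w"
    by (rule min_error_le[OF wD mw])
  moreover have "(1 - t) * hop u + t * hop v \<le> hop w"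
  proof -
    have "(1 - t) * hop u + t * hop v = (\<Sum>\<^sub>\<infinity>k. (1 - t) * (u k * u (k + 1)) + t * (v k * v (k + 1)))"
      by (subst infsum_add) (use u v form_dom_hop_summable in \<open>auto simp: infsum_cmult_right' hop_def[symmetric] intro!: summable_on_cmult_right\<close>)
    also have "\<dots> \<le> hop w"
      unfolding hop_def
    proof (rule infsum_mono)
      show "(\<lambda>k. (1 - t) * (u k * u (k + 1)) + t * (v k * v (k + 1))) summable_on UNIV"
        by (intro summable_on_add summable_on_cmult_right form_dom_hop_summable u v)
      fix k
      let ?a = "sqrt (1 - t) * u k" and ?b = "sqrt t * v k"
      let ?c = "sqrt (1 - t) * u (k + 1)" and ?d = "sqrt t * v (k + 1)"
      have "(1 - t) * (u k * u (k + 1)) + t * (v k * v (k + 1)) = ?a * ?c + ?b * ?d"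
      proof -
        have "?a * ?c + ?b * ?d
            = (sqrt (1 - t) * sqrt (1 - t)) * (u k * u (k + 1)) + (sqrt t * sqrt t) * (v k * v (k + 1))"
          by (simp only: mult_ac)
        then show ?thesis using t by simp
      qed
      also have "\<dots> \<le> sqrt (?a\<^sup>2 + ?b\<^sup>2) * sqrt (?c\<^sup>2 + ?d\<^sup>2)"
        by (rule cauchy_schwarz_two)
      also have "\<dots> = w k * w (k + 1)"
        using t by (simp add: w_def real_sqrt_mult power_mult_distrib)
      finally show "(1 - t) * (u k * u (k + 1)) + t * (v k * v (k + 1)) \<le> w k * w (k + 1)" .
    qed (rule form_dom_hop_summable[OF wD])
    finally show ?thesis .
  qed
  ultimately have "min_error ((1 - t) * x + t * y) \<le> 1 - ((1 - t) * hop u + t * hop v)"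
    by simp
  also have "\<dots> = (1 - t) * min_error x + t * min_error y"
    unfolding u(4)[symmetric] v(4)[symmetric] by (simp add: algebra_simps)
  finally show "min_error ((1 - t) *\<^sub>R x + t *\<^sub>R y) \<le> (1 - t) * min_error x + t * min_error y"
    by simp
qed simp

text \<open>The multiplier is minus the slope of a supporting line of \<^term>\<open>min_error\<close>;
  it is positive because \<^term>\<open>min_error\<close> stays positive but tends to 0.\<close>
lemma min_error_supporting_line:
  assumes E: "E > 0"
  obtains s where "s > 0" "ground s = min_error E + s * E"
proof -
  \<comment> \<open>The infimum of the difference quotients to the right of E is the slope of a
    supporting line there; E > 0 puts E in the interior of the domain.\<close>
  define m where "m = Inf ((\<lambda>t. (min_error E - min_error t) / (E - t)) ` ({E<..} \<inter> {0..}))"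
  have line: "min_error E + m * (y - E) \<le> min_error y" if "y \<ge> 0" for y
    unfolding m_def
    by (rule convex_le_Inf_differential[OF min_error_convex])
       (use E that in \<open>auto simp: interior_real_atLeast\<close>)
  have pos: "min_error E > 0" using min_error_pos E by simp
  obtain n :: nat where n: "n > 0" "1 / real n < min_error E"
    using reals_Archimedean3[OF pos] nat_approx_posE[OF pos] by (metis of_nat_Suc zero_less_Suc)
  obtain y where y: "y \<ge> 0" "min_error y \<le> 1 / real n"
    using min_error_small[OF n(1)] by blast
  \<comment> \<open>A larger budget never increases the minimal error, so a strictly smaller error
    needs a larger budget.\<close>
  have "y > E"
  proof (rule ccontr)
    assume "\<not> y > E"
    obtain v where v: "v \<in> form_dom" "mass v = 1" "energy v \<le> y" "1 - hop v = min_error y"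
      using min_error_attained[OF y(1)] by metis
    have "min_error E \<le> 1 - hop v"
      by (rule min_error_le) (use v \<open>\<not> y > E\<close> in auto)
    then show False using v y n by simp
  qed
  moreover have "m * (y - E) < 0" using line[OF y(1)] y(2) n by simp
  ultimately have "m < 0" by (simp add: mult_less_0_iff)
  define s where "s = - m"
  have s: "s > 0" using \<open>m < 0\<close> by (simp add: s_def)
  \<comment> \<open>Evaluate the supporting line at the energy of v itself, a budget for which v is
    feasible.\<close>
  have lower: "min_error E + s * E \<le> form s v" if v: "v \<in> form_dom" "mass v = 1" for v
  proof -
    have "min_error E + m * (energy v - E) \<le> 1 - hop v"
      using line[OF energy_nonneg] min_error_le[OF v order_refl] by (rule order_trans)
    then show ?thesis using v(2) by (simp add: form_def s_def algebra_simps)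
  qed
  obtain u where u: "u \<in> form_dom" "mass u = 1" "energy u \<le> E" "1 - hop u = min_error E"
    using min_error_attained[of E] E by (metis less_imp_le)
  have "form s u \<le> min_error E + s * E"
    using u s by (simp add: form_def)
  then have "ground s \<le> min_error E + s * E"
    using ground_le_form[OF s u(1)] u(2) by simp
  moreover obtain g where "g \<in> form_dom" "mass g = 1" "form s g = ground s"
    using ground_attained[OF s] by metis
  ultimately have "ground s = min_error E + s * E"
    using lower[of g] by simp
  with s show ?thesis by (rule that)
qed

text \<open>Weak duality: a primal minimizer is a trial sequence for the penalized form.\<close>

lemma ground_le_min_error:
  assumes s: "s > 0" and E: "E > 0"
  shows "ground s \<le> min_error E + s * E"
proof -
  obtain u where u: "u \<in> form_dom" "mass u = 1" "energy u \<le> E" "1 - hop u = min_error E"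
    using min_error_attained[of E] E by (metis less_imp_le)
  have "ground s \<le> form s u"
    using ground_le_form[OF s u(1)] u(2) by simp
  also have "\<dots> \<le> min_error E + s * E"
    using u s by (simp add: form_def)
  finally show ?thesis .
qed

text \<open>A ground state of the dual problem saturates the energy constraint, because it is
  proportional to a minimizer of the primal problem.\<close>
lemma dual_ground_state_hop:
  assumes s: "s > 0" and E: "E > 0" and dual: "ground s = min_error E + s * E"
    and g: "eigenseq s (ground s) g"
  shows "hop g = (1 - min_error E) * mass g"
proof -
  obtain u where u: "u \<in> form_dom" "mass u = 1" "energy u \<le> E" "1 - hop u = min_error E"
    using min_error_attained[of E] E by (metis less_imp_le)
  have "form s u \<le> ground s"
    using u s by (simp add: form_def dual)
  then have "eigenseq s (ground s) u"
    using ground_le_form[OF s u(1)] u(2) by (intro ground_state_eigenseq[OF s u(1)]) simp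
  then obtain t where "g = (\<lambda>k. t * u k)"
    using ground_state_unique[OF s _ _ g] u(2) by (metis zero_neq_one)
  moreover have "hop u = 1 - min_error E" using u(4) by simp
  ultimately show ?thesis
    using u(2) by (simp add: hop_scale mass_scale)
qed

subsection \<open>Completeness of the exponentials\<close>

text \<open>Lebesgue measure without normalization, of total mass 2 pi; factors
  \<open>2 * pi\<close> therefore stay visible below.\<close>

definition circle :: "real measure" where
  "circle = restrict_space lborel {-pi<..pi}"

lemma space_circle [simp]: "space circle = {-pi<..pi}"
  by (simp add: circle_def space_restrict_space)

lemma finite_measure_circle: "finite_measure circle"
  unfolding circle_def by (rule finite_measureI) (simp add: space_restrict_space emeasure_restrict_space)

lemma set_lebesgue_integral_circle:
  fixes f :: "real \<Rightarrow> 'a::{banach, second_countable_topology}"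
  shows "(LINT \<theta>:{-pi<..pi}|lborel. f \<theta>) = integral\<^sup>L circle f"
  unfolding circle_def set_lebesgue_integral_def by (subst integral_restrict_space) auto

lemma set_integrable_circle:
  fixes f :: "real \<Rightarrow> 'a::{banach, second_countable_topology}"
  shows "set_integrable lborel {-pi<..pi} f \<longleftrightarrow> integrable circle f"
  unfolding circle_def set_integrable_def by (subst integrable_restrict_space) auto

lemma measurable_circle_borel: "f \<in> borel_measurable borel \<Longrightarrow> f \<in> borel_measurable circle"
  unfolding circle_def by (rule measurable_restrict_space1) simp

lemma continuous_measurable_circle:
  fixes f :: "real \<Rightarrow> 'a::topological_space"
  shows "continuous_on UNIV f \<Longrightarrow> f \<in> borel_measurable circle"
  by (intro measurable_circle_borel borel_measurable_continuous_onI)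

lemma cis_measurable_circle: "(\<lambda>\<theta>. cis (c * \<theta>)) \<in> borel_measurable circle"
  by (intro continuous_measurable_circle continuous_intros)

lemma integrable_bounded_mult:
  fixes g h :: "'a \<Rightarrow> complex"
  assumes "integrable M h" "g \<in> borel_measurable M" "\<And>x. x \<in> space M \<Longrightarrow> norm (g x) \<le> B"
  shows "integrable M (\<lambda>x. g x * h x)"
proof (rule Bochner_Integration.integrable_bound)
  show "integrable M (\<lambda>x. \<bar>B\<bar> * norm (h x))"
    using assms(1) by simp
  show "(\<lambda>x. g x * h x) \<in> borel_measurable M"
    using assms(1,2) by measurable
  show "AE x in M. norm (g x * h x) \<le> norm (\<bar>B\<bar> * norm (h x))"
    using assms(3) by (intro AE_I2) (force simp: norm_mult intro!: mult_right_mono)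
qed

lemma integrable_cis_mult:
  "integrable circle h \<Longrightarrow> integrable circle (\<lambda>\<theta>. cis (c * \<theta>) * h \<theta>)"
  by (rule integrable_bounded_mult[where B = 1]) (auto intro: cis_measurable_circle)

lemma circle_FTC:
  fixes g :: "real \<Rightarrow> complex"
  assumes "\<And>x. (G has_vector_derivative g x) (at x)" and "continuous_on UNIV g"
  shows "integral\<^sup>L circle g = G pi - G (- pi)"
proof -
  have "has_bochner_integral lborel (\<lambda>x. indicator {-pi..pi} x *\<^sub>R g x) (G pi - G (- pi))"
    by (rule has_bochner_integral_FTC_Icc)
       (use assms in \<open>auto intro: has_vector_derivative_at_within continuous_on_subset\<close>)
  then have "(LINT x|lborel. indicator {-pi..pi} x *\<^sub>R g x) = G pi - G (- pi)"
    by (rule has_bochner_integral_integral_eq)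
  \<comment> \<open>The closed interval of the fundamental theorem and the half-open circle differ
    by the null set {-pi}.\<close>
  moreover have "(LINT x|lborel. indicator {-pi..pi} x *\<^sub>R g x) = (LINT x|lborel. indicator {-pi<..pi} x *\<^sub>R g x)"
  proof (rule integral_cong_AE)
    have [measurable]: "g \<in> borel_measurable borel"
      by (rule borel_measurable_continuous_onI[OF assms(2)])
    show "(\<lambda>x. indicator {-pi..pi} x *\<^sub>R g x) \<in> borel_measurable lborel"
      "(\<lambda>x. indicator {-pi<..pi} x *\<^sub>R g x) \<in> borel_measurable lborel" by measurable
    show "AE x in lborel. indicator {-pi..pi} x *\<^sub>R g x = indicator {-pi<..pi} x *\<^sub>R g x"
      using AE_lborel_singleton[of "- pi"] by eventually_elim (auto simp: indicator_def)
  qed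
  ultimately show ?thesis
    by (simp add: set_lebesgue_integral_circle[symmetric] set_lebesgue_integral_def)
qed

text \<open>Makes the boundary terms at \<open>pi\<close> and \<open>- pi\<close> cancel when
  integrating over the circle.\<close>

lemma cis_of_int_mult_pi: "cis (of_int k * pi) = cis (- (of_int k * pi))"
proof -
  have "cis (of_int k * pi) = cis (- (of_int k * pi) + 2 * pi * of_int k)"
    by (simp add: algebra_simps)
  also have "\<dots> = cis (- (of_int k * pi))"
    unfolding cis_mult[symmetric] by (simp add: cis_multiple_2pi)
  finally show ?thesis .
qed

lemma integral_circle_cis:
  "integral\<^sup>L circle (\<lambda>\<theta>. cis (of_int k * \<theta>)) = (if k = 0 then 2 * pi else 0)"
proof (cases "k = 0")
  case True
  have "integral\<^sup>L circle (\<lambda>\<theta>. 1) = complex_of_real pi - complex_of_real (- pi)"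
    by (rule circle_FTC) (auto intro!: derivative_eq_intros)
  then show ?thesis using True by simp
next
  case False
  have "integral\<^sup>L circle (\<lambda>\<theta>. cis (of_int k * \<theta>))
      = cis (of_int k * pi) / (\<i> * of_int k) - cis (of_int k * - pi) / (\<i> * of_int k)"
  proof (rule circle_FTC)
    show "((\<lambda>\<theta>. cis (of_int k * \<theta>) / (\<i> * of_int k)) has_vector_derivative cis (of_int k * x)) (at x)" for x
      using False
      by (auto intro!: derivative_eq_intros simp: has_vector_derivative_def scaleR_conv_of_real field_simps)
  qed (intro continuous_intros)
  then show ?thesis using False cis_of_int_mult_pi[of k] by simp
qed

text \<open>Multiplication by a trigonometric polynomial, hence by any bounded Borel function of the
  angle, preserves the vanishing of all Fourier coefficients.\<close>
definition vanishing :: "(real \<Rightarrow> complex) \<Rightarrow> bool" where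
  "vanishing h \<longleftrightarrow> integrable circle h \<and> (\<forall>k::int. integral\<^sup>L circle (\<lambda>\<theta>. cis (of_int k * \<theta>) * h \<theta>) = 0)"

lemma vanishing_add: "vanishing g \<Longrightarrow> vanishing h \<Longrightarrow> vanishing (\<lambda>\<theta>. g \<theta> + h \<theta>)"
  by (simp add: vanishing_def distrib_left Bochner_Integration.integral_add integrable_cis_mult)

lemma vanishing_cmult: "vanishing h \<Longrightarrow> vanishing (\<lambda>\<theta>. c * h \<theta>)"
  by (simp add: vanishing_def mult.left_commute[of _ c])

lemma vanishing_cis:
  assumes "vanishing h"
  shows "vanishing (\<lambda>\<theta>. cis (of_int m * \<theta>) * h \<theta>)"
proof -
  have "cis (of_int k * \<theta>) * (cis (of_int m * \<theta>) * h \<theta>) = cis (of_int (k + m) * \<theta>) * h \<theta>" for k \<theta>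
    by (simp add: mult.assoc[symmetric] cis_mult distrib_right)
  then show ?thesis
    using assms unfolding vanishing_def by (simp only: integrable_cis_mult simp_thms)
qed

text \<open>By dominated convergence the admissible multipliers are closed under bounded pointwise
  limits; every extension beyond trigonometric polynomials goes through this.\<close>

lemma vanishing_limit:
  fixes g :: "nat \<Rightarrow> real \<Rightarrow> real"
  assumes h: "integrable circle h"
    and van: "\<And>n. vanishing (\<lambda>\<theta>. of_real (g n \<theta>) * h \<theta>)"
    and meas: "\<And>n. g n \<in> borel_measurable circle" "f \<in> borel_measurable circle"
    and bound: "\<And>n \<theta>. \<theta> \<in> {-pi<..pi} \<Longrightarrow> \<bar>g n \<theta>\<bar> \<le> B"
    and lim: "\<And>\<theta>. \<theta> \<in> {-pi<..pi} \<Longrightarrow> (\<lambda>n. g n \<theta>) \<longlonglongrightarrow> f \<theta>"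
  shows "vanishing (\<lambda>\<theta>. of_real (f \<theta>) * h \<theta>)"
proof -
  have fB: "\<bar>f \<theta>\<bar> \<le> B" if "\<theta> \<in> {-pi<..pi}" for \<theta>
    by (rule LIMSEQ_le_const2[OF tendsto_rabs[OF lim[OF that]]]) (use bound[OF that] in auto)
  have int: "integrable circle (\<lambda>\<theta>. of_real (f \<theta>) * h \<theta>)"
    by (rule integrable_bounded_mult[OF h, where B = B]) (use meas fB in auto)
  have "integral\<^sup>L circle (\<lambda>\<theta>. cis (of_int k * \<theta>) * (of_real (f \<theta>) * h \<theta>)) = 0" for k
  proof -
    have [measurable]: "(\<lambda>\<theta>. cis (of_int k * \<theta>)) \<in> borel_measurable circle" "h \<in> borel_measurable circle"
      using cis_measurable_circle h by auto
    note meas[measurable]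
    have "(\<lambda>n. integral\<^sup>L circle (\<lambda>\<theta>. cis (of_int k * \<theta>) * (of_real (g n \<theta>) * h \<theta>)))
        \<longlonglongrightarrow> integral\<^sup>L circle (\<lambda>\<theta>. cis (of_int k * \<theta>) * (of_real (f \<theta>) * h \<theta>))"
    proof (rule integral_dominated_convergence[where w = "\<lambda>\<theta>. B * norm (h \<theta>)"])
      show "AE \<theta> in circle. (\<lambda>n. cis (of_int k * \<theta>) * (of_real (g n \<theta>) * h \<theta>))
          \<longlonglongrightarrow> cis (of_int k * \<theta>) * (of_real (f \<theta>) * h \<theta>)"
        by (intro AE_I2 tendsto_intros lim) simp
      show "AE \<theta> in circle. norm (cis (of_int k * \<theta>) * (of_real (g n \<theta>) * h \<theta>)) \<le> B * norm (h \<theta>)" for n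
        by (intro AE_I2) (use bound in \<open>auto simp: norm_mult intro!: mult_right_mono\<close>)
    qed (use h in auto)
    then show ?thesis
      using van by (simp add: vanishing_def LIMSEQ_const_iff)
  qed
  with int show ?thesis by (simp add: vanishing_def)
qed

lemma vanishing_polynomial:
  assumes "real_polynomial_function p" "vanishing h"
  shows "vanishing (\<lambda>\<theta>. of_real (p (cis \<theta>)) * h \<theta>)"
  using assms
\<comment> \<open>\<open>h\<close> is generalized since a product is treated by applying the claim
  for one factor to \<open>h\<close> already multiplied by the other.\<close>
proof (induction p arbitrary: h)
  case (linear f)
  \<comment> \<open>On the circle a real-linear functional equals cos \<theta> * f 1 + sin \<theta>
    * f \<i>, a combination of the modes 1 and -1 with conjugate coefficients.\<close>
  define a where "a = (of_real (f 1) - \<i> * of_real (f \<i>)) / 2"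
  have "of_real (f (cis \<theta>)) = a * cis (of_int 1 * \<theta>) + cnj a * cis (of_int (- 1) * \<theta>)" for \<theta>
  proof -
    interpret f: bounded_linear f by (rule linear)
    have "cis \<theta> = cos \<theta> *\<^sub>R 1 + sin \<theta> *\<^sub>R \<i>"
      by (simp add: complex_eq_iff)
    then have "f (cis \<theta>) = cos \<theta> * f 1 + sin \<theta> * f \<i>"
      by (simp only: f.add f.scaleR real_scaleR_def)
    then show ?thesis
      by (simp add: a_def complex_eq_iff field_simps)
  qed
  then show ?case
    using vanishing_add[OF vanishing_cmult[OF vanishing_cis[OF linear(2), of 1], of a]
        vanishing_cmult[OF vanishing_cis[OF linear(2), of "- 1"], of "cnj a"]]
    by (simp only: distrib_right mult.assoc)
next
  case (const c)
  then show ?case by (rule vanishing_cmult)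
next
  case (add f g)
  show ?case
    using vanishing_add[OF add.IH(1)[OF add.prems] add.IH(2)[OF add.prems]] by (simp add: distrib_right)
next
  case (mult f g)
  show ?case
    using mult.IH(1)[OF mult.IH(2)[OF mult.prems]] by (simp add: mult.assoc)
qed

lemma compose_cis_measurable: 
  "f \<in> borel_measurable borel \<Longrightarrow> (\<lambda>\<theta>. f (cis \<theta>)) \<in> borel_measurable circle"
  using measurable_compose[OF cis_measurable_circle[of 1]] by simp

text \<open>Stone-Weierstrass on the unit circle; a bound for f plus the approximation error 1
  bounds all approximants uniformly.\<close>

lemma vanishing_continuous:
  fixes f :: "complex \<Rightarrow> real"
  assumes f: "continuous_on UNIV f" and h: "vanishing h"
  shows "vanishing (\<lambda>\<theta>. of_real (f (cis \<theta>)) * h \<theta>)"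
proof -
  let ?S = "sphere 0 1 :: complex set"
  have fS: "continuous_on ?S f" using f continuous_on_subset by blast
  have "\<exists>p. real_polynomial_function p \<and> (\<forall>z\<in>?S. \<bar>f z - p z\<bar> < 1 / real (Suc n))" for n
  proof -
    have "0 < 1 / real (Suc n)" by simp
    then obtain p where "real_polynomial_function p" "\<And>z. z \<in> ?S \<Longrightarrow> \<bar>f z - p z\<bar> < 1 / real (Suc n)"
      using Stone_Weierstrass_real_polynomial_function[OF compact_sphere fS] by blast
    then show ?thesis by blast
  qed
  then have "\<exists>p. \<forall>n. real_polynomial_function (p n) \<and> (\<forall>z\<in>?S. \<bar>f z - p n z\<bar> < 1 / real (Suc n))"
    by (rule choice[OF allI])
  then obtain p where "\<forall>n. real_polynomial_function (p n) \<and> (\<forall>z\<in>?S. \<bar>f z - p n z\<bar> < 1 / real (Suc n))"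
    by (rule exE)
  then have p: "real_polynomial_function (p n)"
    and close: "z \<in> ?S \<Longrightarrow> \<bar>f z - p n z\<bar> < 1 / real (Suc n)" for n z
    by blast+
  obtain B where B: "\<And>z. z \<in> ?S \<Longrightarrow> \<bar>f z\<bar> \<le> B"
  proof -
    have "bounded (f ` ?S)"
      by (rule compact_imp_bounded[OF compact_continuous_image[OF fS compact_sphere]])
    then obtain B where "\<forall>x\<in>f ` ?S. norm x \<le> B"
      unfolding bounded_iff by (rule exE)
    then show ?thesis by (intro that[of B]) force
  qed
  have one: "1 / real (Suc n) \<le> 1" for n by simp
  show ?thesis
  proof (rule vanishing_limit[where g = "\<lambda>n \<theta>. p n (cis \<theta>)" and B = "B + 1"])
    show "integrable circle h" using h by (simp add: vanishing_def)
    show "vanishing (\<lambda>\<theta>. of_real (p n (cis \<theta>)) * h \<theta>)" for n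
      by (rule vanishing_polynomial[OF p h])
    have "continuous_on UNIV (p n)" for n
      using p[of n] by (intro continuous_on_polymonial_function) (simp only: real_polynomial_function_eq)
    then show "(\<lambda>\<theta>. p n (cis \<theta>)) \<in> borel_measurable circle" for n
      by (intro compose_cis_measurable borel_measurable_continuous_onI)
    show "(\<lambda>\<theta>. f (cis \<theta>)) \<in> borel_measurable circle"
      by (intro compose_cis_measurable borel_measurable_continuous_onI f)
    fix \<theta> :: real
    have S: "cis \<theta> \<in> ?S" by simp
    show "\<bar>p n (cis \<theta>)\<bar> \<le> B + 1" for n
      using close[OF S, of n] B[OF S] one[of n] by linarith
    show "(\<lambda>n. p n (cis \<theta>)) \<longlonglongrightarrow> f (cis \<theta>)"
    proof (rule Lim_null_comparison[THEN LIM_zero_cancel])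
      show "(\<lambda>n. 1 / real (Suc n)) \<longlonglongrightarrow> 0" by (rule LIMSEQ_Suc[OF lim_1_over_n])
      have "norm (p n (cis \<theta>) - f (cis \<theta>)) \<le> 1 / real (Suc n)" for n
        using close[OF S, of n] unfolding real_norm_def by linarith
      then show "\<forall>\<^sub>F n in sequentially. norm (p n (cis \<theta>) - f (cis \<theta>)) \<le> 1 / real (Suc n)"
        by (rule always_eventually[OF allI])
    qed
  qed
qed

lemma vanishing_open:
  fixes U :: "complex set"
  assumes U: "open U" and h: "vanishing h"
  shows "vanishing (\<lambda>\<theta>. of_real (indicat_real U (cis \<theta>)) * h \<theta>)"
\<comment> \<open>\<open>infdist\<close> to the empty set is 0 by convention, so the cutoffs built
  from the distance to the complement would fail for the whole plane.\<close>
proof (cases "U = UNIV")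
  case True
  then show ?thesis using h by simp
next
  case False
  then have ne: "- U \<noteq> {}" by auto
  define g where "g n z = min 1 (real n * infdist z (- U))" for n z
  have gc: "continuous_on UNIV (g n)" for n
    unfolding g_def by (intro continuous_intros)
  show ?thesis
  proof (rule vanishing_limit[where g = "\<lambda>n \<theta>. g n (cis \<theta>)" and B = 1])
    show "integrable circle h" using h by (simp add: vanishing_def)
    show "vanishing (\<lambda>\<theta>. of_real (g n (cis \<theta>)) * h \<theta>)" for n
      by (rule vanishing_continuous[OF gc h])
    show "(\<lambda>\<theta>. g n (cis \<theta>)) \<in> borel_measurable circle" for n
      by (intro compose_cis_measurable borel_measurable_continuous_onI gc)
    show "(\<lambda>\<theta>. indicat_real U (cis \<theta>)) \<in> borel_measurable circle"
      by (intro compose_cis_measurable borel_measurable_indicator) (simp add: U)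
    show "\<bar>g n (cis \<theta>)\<bar> \<le> 1" for n \<theta>
      by (simp add: g_def infdist_nonneg)
    fix \<theta> :: real
    show "(\<lambda>n. g n (cis \<theta>)) \<longlonglongrightarrow> indicat_real U (cis \<theta>)"
    proof (cases "cis \<theta> \<in> U")
      case True
      then have "infdist (cis \<theta>) (- U) > 0"
        using ne U by (intro infdist_pos_not_in_closed) (auto simp: closed_Compl)
      then obtain N where N: "real N * infdist (cis \<theta>) (- U) > 1"
        using reals_Archimedean3[of "infdist (cis \<theta>) (- U)"] by blast
      have "g n (cis \<theta>) = 1" if "n \<ge> N" for n
      proof -
        have "1 < real n * infdist (cis \<theta>) (- U)"
          using N that by (elim less_le_trans) (intro mult_right_mono infdist_nonneg, simp)
        then show ?thesis by (simp add: g_def)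
      qed
      then have "\<forall>\<^sub>F n in sequentially. g n (cis \<theta>) = 1"
        unfolding eventually_sequentially by blast
      then show ?thesis using True by (simp add: tendsto_eventually)
    next
      case False
      then show ?thesis by (simp add: g_def)
    qed
  qed
qed

text \<open>Dynkin's pi-lambda argument with the open sets as intersection-stable generator;
  countable disjoint unions are bounded limits of finite ones.\<close>

lemma vanishing_borel:
  fixes A :: "complex set"
  assumes "A \<in> sets borel" and h: "vanishing h"
  shows "vanishing (\<lambda>\<theta>. of_real (indicat_real A (cis \<theta>)) * h \<theta>)"
proof -
  have hi: "integrable circle h" using h by (simp add: vanishing_def)
  have "Int_stable (Collect (open :: complex set \<Rightarrow> bool))" "Collect open \<subseteq> Pow (UNIV :: complex set)"
    by (auto simp: Int_stable_def)
  moreover have "A \<in> sigma_sets UNIV (Collect open)"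
    using assms(1) by (simp add: borel_def)
  ultimately show ?thesis
  proof (induction rule: sigma_sets_induct_disjoint)
    case (basic A)
    then show ?case using vanishing_open[OF _ h] by simp
  next
    case empty
    then show ?case using vanishing_cmult[OF h, of 0] by simp
  next
    case (compl A)
    have "indicat_real (UNIV - A) z = 1 - indicat_real A z" for z
      by (simp add: indicator_def)
    then show ?case
      using vanishing_add[OF h vanishing_cmult[OF compl(2), of "- 1"]] by (simp add: left_diff_distrib)
  next
    case (union A)
    have meas: "A i \<in> sets borel" for i
      using union(2) by (auto simp: borel_def)
    show ?case
    proof (rule vanishing_limit[OF hi, where g = "\<lambda>n \<theta>. indicat_real (\<Union>i<n. A i) (cis \<theta>)" and B = 1])
      show "vanishing (\<lambda>\<theta>. of_real (indicat_real (\<Union>i<n. A i) (cis \<theta>)) * h \<theta>)" for n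
      proof (induction n)
        case 0
        then show ?case using vanishing_cmult[OF h, of 0] by simp
      next
        case (Suc n)
        have "A n \<inter> A i = {}" if "i < n" for i
          using disjoint_family_onD[OF union(1), of n i] that by simp
        then have "A n \<inter> (\<Union>i<n. A i) = {}" by blast
        then have "indicat_real (\<Union>i<Suc n. A i) z = indicat_real (A n) z + indicat_real (\<Union>i<n. A i) z" for z
          by (auto simp: lessThan_Suc indicator_def)
        then show ?case
          using vanishing_add[OF union(3)[of n] Suc] by (simp add: distrib_right)
      qed
      show "(\<lambda>\<theta>. indicat_real (\<Union>i<n. A i) (cis \<theta>)) \<in> borel_measurable circle" for n
        using meas by (intro compose_cis_measurable borel_measurable_indicator) auto
      show "(\<lambda>\<theta>. indicat_real (\<Union>i. A i) (cis \<theta>)) \<in> borel_measurable circle"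
        using meas by (intro compose_cis_measurable borel_measurable_indicator) auto
      show "\<bar>indicat_real (\<Union>i<n. A i) (cis \<theta>)\<bar> \<le> 1" for n \<theta>
        by (simp add: indicator_def)
      show "(\<lambda>n. indicat_real (\<Union>i<n. A i) (cis \<theta>)) \<longlonglongrightarrow> indicat_real (\<Union>i. A i) (cis \<theta>)" for \<theta>
        by (rule LIMSEQ_indicator_UN)
    qed
  qed
qed

text \<open>The half-angle formula gives a Borel left inverse of \<open>cis\<close> on the open
  interval, so Borel sets of angles are pulled back from the plane up to the null set {pi}.\<close>

lemma angle_of_cis:
  assumes "- pi < \<theta>" "\<theta> < pi"
  shows "2 * arctan (Im (cis \<theta>) / (1 + Re (cis \<theta>))) = \<theta>"
proof -
  have "sin \<theta> / (1 + cos \<theta>) = tan (\<theta> / 2)"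
    using tan_half[of "\<theta> / 2"] by (simp add: add.commute)
  then show ?thesis using assms by (simp add: arctan_tan)
qed

text \<open>Multiply h by the indicator of the set where Re h is positive: the integral is still
  zero, but its real part has a nonnegative integrand.\<close>

lemma vanishing_Re_nonpos:
  assumes h: "vanishing h"
  shows "AE \<theta> in circle. Re (h \<theta>) \<le> 0"
proof -
  have hi: "integrable circle h" using h by (simp add: vanishing_def)
  then have [measurable]: "h \<in> borel_measurable circle" by simp
  define B where "B = {\<theta> \<in> space circle. Re (h \<theta>) > 0}"
  have Bc: "B \<in> sets circle" unfolding B_def by measurable
  then have Bm: "B \<in> sets borel"
    by (simp add: circle_def sets_restrict_space_iff)
  define A where "A = (\<lambda>z. 2 * arctan (Im z / (1 + Re z))) -` B \<inter> space borel"
  have Am: "A \<in> sets borel"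
    unfolding A_def using Bm by (rule measurable_sets[rotated]) measurable
  have "indicat_real A (cis \<theta>) = indicat_real B \<theta>" if "- pi < \<theta>" "\<theta> < pi" for \<theta>
    using angle_of_cis[OF that] by (simp add: A_def indicator_def)
  then have "AE \<theta> in lborel. \<theta> \<in> {-pi<..pi} \<longrightarrow> indicat_real A (cis \<theta>) = indicat_real B \<theta>"
    using AE_lborel_singleton[of pi] by (auto elim!: eventually_mono)
  then have ae: "AE \<theta> in circle. indicat_real A (cis \<theta>) = indicat_real B \<theta>"
    unfolding circle_def by (subst AE_restrict_space_iff) auto
  have [measurable]: "(\<lambda>\<theta>. indicat_real A (cis \<theta>)) \<in> borel_measurable circle"
    using Am by (intro compose_cis_measurable borel_measurable_indicator)
  have int: "integrable circle (\<lambda>\<theta>. of_real (indicat_real B \<theta>) * h \<theta>)"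
    by (rule integrable_bounded_mult[OF hi, where B = 1]) (use Bc in \<open>auto simp: indicator_def\<close>)
  have "integral\<^sup>L circle (\<lambda>\<theta>. of_real (indicat_real B \<theta>) * h \<theta>)
      = integral\<^sup>L circle (\<lambda>\<theta>. of_real (indicat_real A (cis \<theta>)) * h \<theta>)"
    by (rule integral_cong_AE) (use ae Bc in \<open>auto elim: eventually_mono\<close>)
  also have "\<dots> = 0"
    using vanishing_borel[OF Am h] unfolding vanishing_def by (auto dest: spec[where x = 0])
  finally have "integral\<^sup>L circle (\<lambda>\<theta>. Re (of_real (indicat_real B \<theta>) * h \<theta>)) = 0"
    using int by (simp only: integral_Re zero_complex.sel)
  moreover have "Re (of_real (indicat_real B \<theta>) * h \<theta>) \<ge> 0" for \<theta>
    by (simp add: B_def indicator_def)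
  ultimately have "AE \<theta> in circle. Re (of_real (indicat_real B \<theta>) * h \<theta>) = 0"
    by (intro integral_nonneg_eq_0_iff_AE[OF integrable_Re[OF int], THEN iffD1] AE_I2)
  then show ?thesis
    by (rule AE_mp) (auto simp: B_def indicator_def intro!: AE_I2)
qed

lemma vanishing_AE_zero:
  assumes h: "vanishing h"
  shows "AE \<theta> in circle. h \<theta> = 0"
proof -
  have "AE \<theta> in circle. Re (c * h \<theta>) \<le> 0" for c
    by (rule vanishing_Re_nonpos[OF vanishing_cmult[OF h]])
  \<comment> \<open>The four multiples bound Re h and Im h from both sides.\<close>
  from this[of 1] this[of "- 1"] this[of \<i>] this[of "- \<i>"] show ?thesis
    by eventually_elim (simp add: complex_eq_iff)
qed

subsection \<open>Absolutely convergent Fourier series\<close>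

definition fseries :: "(int \<Rightarrow> complex) \<Rightarrow> real \<Rightarrow> complex" where
  "fseries \<phi> \<theta> = (\<Sum>\<^sub>\<infinity>k. \<phi> k * cis (of_int k * \<theta>))"

text \<open>Enumerating the integers turns unordered sums into series, the form in which termwise
  integration and differentiation are carried out.\<close>

lemma has_sum_imp_sums_int_decode:
  assumes "(f has_sum S) (UNIV :: int set)"
  shows "(\<lambda>n. f (int_decode n)) sums S"
  using assms has_sum_reindex_bij_betw[OF bij_int_decode, of f S] by (intro has_sum_imp_sums) simp

lemma summable_on_imp_summable_int_decode:
  fixes f :: "int \<Rightarrow> 'a::real_normed_vector"
  shows "f summable_on (UNIV :: int set) \<Longrightarrow> summable (\<lambda>n. f (int_decode n))"
  by (rule sums_summable[OF has_sum_imp_sums_int_decode[OF has_sum_infsum]])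

lemma fourier_coeff_circle:
  "fourier_coeff f k = integral\<^sup>L circle (\<lambda>\<theta>. cis (of_int (- k) * \<theta>) * f \<theta>) / (2 * pi)"
  by (simp add: fourier_coeff_def set_lebesgue_integral_circle cis_conv_exp mult.assoc)

context
  fixes \<phi> :: "int \<Rightarrow> complex"
  assumes abs_sum: "(\<lambda>k. norm (\<phi> k)) summable_on UNIV"
begin

lemma fseries_has_sum: "((\<lambda>k. \<phi> k * cis (of_int k * \<theta>)) has_sum fseries \<phi> \<theta>) UNIV"
  unfolding fseries_def
  by (rule has_sum_infsum[OF abs_summable_summable]) (simp add: norm_mult abs_sum)

lemma norm_fseries_le: "norm (fseries \<phi> \<theta>) \<le> (\<Sum>\<^sub>\<infinity>k. norm (\<phi> k))"
  using norm_infsum_bound[of "\<lambda>k. \<phi> k * cis (of_int k * \<theta>)" UNIV]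
  by (simp add: fseries_def norm_mult abs_sum)

lemma fseries_eq_suminf: "fseries \<phi> \<theta> = (\<Sum>n. \<phi> (int_decode n) * cis (of_int (int_decode n) * \<theta>))"
  using has_sum_imp_sums_int_decode[OF fseries_has_sum] by (simp add: sums_iff)

lemma fseries_measurable: "fseries \<phi> \<in> borel_measurable borel"
proof -
  have "(\<lambda>\<theta>. \<phi> k * cis (of_int k * \<theta>)) \<in> borel_measurable borel" for k
    by (intro borel_measurable_continuous_onI continuous_intros)
  then have "(\<lambda>\<theta>. \<Sum>n. \<phi> (int_decode n) * cis (of_int (int_decode n) * \<theta>)) \<in> borel_measurable borel"
    by (rule borel_measurable_suminf)
  then show ?thesis
    by (simp only: fseries_eq_suminf[symmetric, abs_def] cong: measurable_cong)
qed

lemma integrable_fseries_mult: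
  "integrable circle g \<Longrightarrow> integrable circle (\<lambda>\<theta>. fseries \<phi> \<theta> * g \<theta>)"
  by (rule integrable_bounded_mult[OF _ measurable_circle_borel[OF fseries_measurable] norm_fseries_le])

lemma integrable_fseries: "integrable circle (fseries \<phi>)"
proof -
  interpret finite_measure circle by (rule finite_measure_circle)
  show ?thesis using integrable_fseries_mult[of "\<lambda>_. 1"] by simp
qed

text \<open>Termwise integration along the enumeration identifies the value; absolute summability of
  the terms makes it the unordered sum. Parseval and its cosine variant are special choices of
  g.\<close>

lemma integral_fseries_mult:
  assumes g: "integrable circle g"
  shows "((\<lambda>k. \<phi> k * integral\<^sup>L circle (\<lambda>\<theta>. cis (of_int k * \<theta>) * g \<theta>))
    has_sum integral\<^sup>L circle (\<lambda>\<theta>. fseries \<phi> \<theta> * g \<theta>)) UNIV"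
proof -
  define G where "G k \<theta> = \<phi> k * (cis (of_int k * \<theta>) * g \<theta>)" for k \<theta>
  define c where "c k = \<phi> k * integral\<^sup>L circle (\<lambda>\<theta>. cis (of_int k * \<theta>) * g \<theta>)" for k
  have Gi: "integrable circle (G k)" for k
    unfolding G_def using integrable_cis_mult[OF g] by simp
  have Gc: "integral\<^sup>L circle (G k) = c k" for k
    by (simp add: G_def[abs_def] c_def)
  have nG: "norm (G k \<theta>) = norm (\<phi> k) * norm (g \<theta>)" for k \<theta>
    by (simp add: G_def norm_mult)
  have sm: "summable (\<lambda>n. norm (\<phi> (int_decode n)))"
    using summable_on_imp_summable_int_decode[OF abs_sum] .
  have "(\<lambda>n. integral\<^sup>L circle (G (int_decode n))) sums (\<integral>\<theta>. (\<Sum>n. G (int_decode n) \<theta>) \<partial>circle)"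
  proof (rule sums_integral)
    show "AE \<theta> in circle. summable (\<lambda>n. norm (G (int_decode n) \<theta>))"
      by (intro AE_I2) (simp add: nG summable_mult2 sm)
    show "summable (\<lambda>n. \<integral>\<theta>. norm (G (int_decode n) \<theta>) \<partial>circle)"
      by (simp add: nG summable_mult2 sm)
  qed (rule Gi)
  moreover have "(\<Sum>n. G (int_decode n) \<theta>) = fseries \<phi> \<theta> * g \<theta>" for \<theta>
  proof -
    have "(\<lambda>n. \<phi> (int_decode n) * cis (of_int (int_decode n) * \<theta>) * g \<theta>) sums (fseries \<phi> \<theta> * g \<theta>)"
      by (rule sums_mult2[OF has_sum_imp_sums_int_decode[OF fseries_has_sum]])
    then show ?thesis by (simp add: G_def sums_iff mult.assoc)
  qed
  ultimately have s: "(\<lambda>n. c (int_decode n)) sums integral\<^sup>L circle (\<lambda>\<theta>. fseries \<phi> \<theta> * g \<theta>)"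
    by (simp add: Gc)
  have "norm (c k) \<le> norm (\<phi> k) * integral\<^sup>L circle (\<lambda>\<theta>. norm (g \<theta>))" for k
    using integral_norm_bound[of circle "G k"] by (simp add: Gc nG)
  then have "(\<lambda>k. norm (c k)) summable_on UNIV"
    by (intro Infinite_Sum.abs_summable_on_comparison_test'[OF summable_on_cmult_left[OF abs_sum]])
  then have "(c has_sum infsum c UNIV) UNIV"
    by (rule has_sum_infsum[OF abs_summable_summable])
  moreover from has_sum_imp_sums_int_decode[OF this] s
  have "infsum c UNIV = integral\<^sup>L circle (\<lambda>\<theta>. fseries \<phi> \<theta> * g \<theta>)"
    by (rule sums_unique2)
  ultimately show ?thesis by (simp add: c_def[abs_def])
qed

lemma integral_cis_mult_fseries:
  "integral\<^sup>L circle (\<lambda>\<theta>. cis (of_int m * \<theta>) * fseries \<phi> \<theta>) = 2 * pi * \<phi> (- m)"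
proof -
  interpret finite_measure circle by (rule finite_measure_circle)
  have "integrable circle (\<lambda>\<theta>. cis (of_int m * \<theta>) * 1)"
    by (intro integrable_cis_mult) simp
  then have g: "integrable circle (\<lambda>\<theta>. cis (of_int m * \<theta>))" by simp
  have "integral\<^sup>L circle (\<lambda>\<theta>. cis (of_int k * \<theta>) * cis (of_int m * \<theta>)) = (if k = - m then 2 * pi else 0)" for k
    using integral_circle_cis[of "k + m"] by (simp add: cis_mult distrib_right add_eq_0_iff2)
  then have "((\<lambda>k. \<phi> k * (if k = - m then 2 * pi else 0)) has_sum
      integral\<^sup>L circle (\<lambda>\<theta>. fseries \<phi> \<theta> * cis (of_int m * \<theta>))) UNIV"
    using integral_fseries_mult[OF g] by simp
  moreover have "((\<lambda>k. \<phi> k * (if k = - m then 2 * pi else 0)) has_sum \<phi> (- m) * (2 * pi)) UNIV"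
    by (rule has_sum_finite_neutralI[where B = "{- m}"]) auto
  ultimately show ?thesis
    using has_sum_unique by (fastforce simp: mult.commute)
qed

lemma fourier_coeff_fseries: "fourier_coeff (fseries \<phi>) k = \<phi> k"
  unfolding fourier_coeff_circle integral_cis_mult_fseries by simp

lemma integrable_cnj_fseries: "integrable circle (\<lambda>\<theta>. cnj (fseries \<phi> \<theta>))"
  using integrable_fseries by simp

lemma integral_cis_mult_cnj_fseries:
  "integral\<^sup>L circle (\<lambda>\<theta>. cis (of_int m * \<theta>) * cnj (fseries \<phi> \<theta>)) = 2 * pi * cnj (\<phi> m)"
proof -
  have "integral\<^sup>L circle (\<lambda>\<theta>. cis (of_int m * \<theta>) * cnj (fseries \<phi> \<theta>))
      = integral\<^sup>L circle (\<lambda>\<theta>. cnj (cis (of_int (- m) * \<theta>) * fseries \<phi> \<theta>))"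
    by (simp add: cis_cnj)
  also have "\<dots> = cnj (2 * pi * \<phi> m)"
    by (subst Bochner_Integration.integral_cnj) (simp only: integral_cis_mult_fseries minus_minus)
  finally show ?thesis by simp
qed

lemma fseries_square_has_sum:
  "((\<lambda>k. 2 * pi * (cmod (\<phi> k))\<^sup>2) has_sum integral\<^sup>L circle (\<lambda>\<theta>. (cmod (fseries \<phi> \<theta>))\<^sup>2)) UNIV"
proof -
  have "((\<lambda>k. \<phi> k * (2 * pi * cnj (\<phi> k))) has_sum
      integral\<^sup>L circle (\<lambda>\<theta>. fseries \<phi> \<theta> * cnj (fseries \<phi> \<theta>))) UNIV"
    using integral_fseries_mult[OF integrable_cnj_fseries] by (simp only: integral_cis_mult_cnj_fseries)
  moreover have "\<phi> k * (2 * pi * cnj (\<phi> k)) = complex_of_real (2 * pi * (cmod (\<phi> k))\<^sup>2)" for k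
    using complex_norm_square[of "\<phi> k"] by (simp add: mult_ac)
  ultimately show ?thesis
    by (simp only: complex_norm_square[symmetric] has_sum_of_real_iff integral_complex_of_real)
qed

text \<open>Take g as cos times the conjugate series: multiplication by cos averages the two
  neighbouring modes.\<close>

lemma fseries_cos_has_sum:
  "((\<lambda>k. pi * Re (\<phi> k * cnj (\<phi> (k + 1)) + \<phi> k * cnj (\<phi> (k - 1)))) has_sum
    integral\<^sup>L circle (\<lambda>\<theta>. cos \<theta> * (cmod (fseries \<phi> \<theta>))\<^sup>2)) UNIV"
proof -
  define g where "g \<theta> = complex_of_real (cos \<theta>) * cnj (fseries \<phi> \<theta>)" for \<theta>
  have g_eq: "cis (of_int k * \<theta>) * g \<theta> = 1/2 * (cis (of_int (k + 1) * \<theta>) * cnj (fseries \<phi> \<theta>))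
      + 1/2 * (cis (of_int (k - 1) * \<theta>) * cnj (fseries \<phi> \<theta>))" for k \<theta>
  proof -
    have "complex_of_real (cos \<theta>) = (cis \<theta> + cis (- \<theta>)) / 2"
      by (simp add: complex_eq_iff)
    moreover have "cis (of_int (k + 1) * \<theta>) = cis (of_int k * \<theta>) * cis \<theta>"
      "cis (of_int (k - 1) * \<theta>) = cis (of_int k * \<theta>) * cis (- \<theta>)"
      by (simp_all add: cis_mult algebra_simps)
    ultimately show ?thesis by (simp only: g_def) (simp add: algebra_simps add_divide_distrib)
  qed
  have gi: "integrable circle g"
    unfolding g_def
    by (rule integrable_bounded_mult[OF integrable_cnj_fseries, where B = 1])
       (auto intro!: continuous_measurable_circle continuous_intros)
  have "integral\<^sup>L circle (\<lambda>\<theta>. cis (of_int k * \<theta>) * g \<theta>) = pi * (cnj (\<phi> (k + 1)) + cnj (\<phi> (k - 1)))" for k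
  proof -
    have i: "integrable circle (\<lambda>\<theta>. 1/2 * (cis (of_int m * \<theta>) * cnj (fseries \<phi> \<theta>)))" for m
      using integrable_cis_mult[OF integrable_cnj_fseries] by (rule integrable_mult_right)
    have "integral\<^sup>L circle (\<lambda>\<theta>. cis (of_int k * \<theta>) * g \<theta>)
        = 1/2 * (2 * pi * cnj (\<phi> (k + 1))) + 1/2 * (2 * pi * cnj (\<phi> (k - 1)))"
      unfolding g_eq Bochner_Integration.integral_add[OF i i]
      by (simp only: integral_mult_right_zero integral_cis_mult_cnj_fseries)
    then show ?thesis by (simp add: distrib_left)
  qed
  then have "((\<lambda>k. \<phi> k * (pi * (cnj (\<phi> (k + 1)) + cnj (\<phi> (k - 1))))) has_sum
      integral\<^sup>L circle (\<lambda>\<theta>. fseries \<phi> \<theta> * g \<theta>)) UNIV"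
    using integral_fseries_mult[OF gi] by simp
  moreover have "fseries \<phi> \<theta> * g \<theta> = complex_of_real (cos \<theta> * (cmod (fseries \<phi> \<theta>))\<^sup>2)" for \<theta>
    using complex_norm_square[of "fseries \<phi> \<theta>"] by (simp add: g_def mult_ac)
  ultimately have "((\<lambda>k. Re (\<phi> k * (pi * (cnj (\<phi> (k + 1)) + cnj (\<phi> (k - 1)))))) has_sum
      Re (complex_of_real (integral\<^sup>L circle (\<lambda>\<theta>. cos \<theta> * (cmod (fseries \<phi> \<theta>))\<^sup>2)))) UNIV"
    by (intro has_sum_Re) (simp only: integral_complex_of_real)
  then show ?thesis
    by (simp add: algebra_simps)
qed

end

text \<open>Completeness enters here: f minus its Fourier series is integrable and all its
  coefficients vanish.\<close>

lemma AE_eq_fseries: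
  assumes f: "integrable circle f" and "(\<lambda>k. norm (fourier_coeff f k)) summable_on UNIV"
  shows "AE \<theta> in circle. f \<theta> = fseries (fourier_coeff f) \<theta>"
proof -
  let ?F = "fseries (fourier_coeff f)"
  have "vanishing (\<lambda>\<theta>. f \<theta> - ?F \<theta>)"
    unfolding vanishing_def
  proof (intro conjI allI)
    show "integrable circle (\<lambda>\<theta>. f \<theta> - ?F \<theta>)"
      by (intro Bochner_Integration.integrable_diff f integrable_fseries assms)
    fix k
    have "integral\<^sup>L circle (\<lambda>\<theta>. cis (of_int k * \<theta>) * f \<theta>) = 2 * pi * fourier_coeff f (- k)"
      by (simp add: fourier_coeff_circle)
    moreover have "integral\<^sup>L circle (\<lambda>\<theta>. cis (of_int k * \<theta>) * ?F \<theta>) = 2 * pi * fourier_coeff f (- k)"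
      by (rule integral_cis_mult_fseries[OF assms(2)])
    ultimately show "integral\<^sup>L circle (\<lambda>\<theta>. cis (of_int k * \<theta>) * (f \<theta> - ?F \<theta>)) = 0"
      by (simp add: right_diff_distrib Bochner_Integration.integral_diff integrable_cis_mult f
          integrable_fseries[OF assms(2)])
  qed
  from vanishing_AE_zero[OF this] show ?thesis by simp
qed

section \<open>Complex sequences as pairs of real ones, and Parseval identities\<close>

lemma complex_form_dom:
  assumes "(\<lambda>k. (of_int k)\<^sup>2 * (cmod (\<phi> k))\<^sup>2) summable_on (UNIV :: int set)"
  shows "(\<lambda>k. Re (\<phi> k)) \<in> form_dom" "(\<lambda>k. Im (\<phi> k)) \<in> form_dom"
proof -
  \<comment> \<open>For k \<noteq> 0 one has 1 + k^2 \<le> 2 k^2; the weight k^2 says nothing about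
    index 0, whose single term is added by hand.\<close>
  let ?d = "\<lambda>k::int. if k = 0 then (cmod (\<phi> 0))\<^sup>2 else 0"
  have s: "(\<lambda>k. 2 * ((of_int k)\<^sup>2 * (cmod (\<phi> k))\<^sup>2) + ?d k) summable_on UNIV"
    by (intro summable_on_add summable_on_cmult_right assms summable_on_single)
  have b: "(1 + (of_int k)\<^sup>2) * x\<^sup>2 \<le> 2 * ((of_int k)\<^sup>2 * (cmod (\<phi> k))\<^sup>2) + ?d k"
    if x: "\<bar>x\<bar> \<le> cmod (\<phi> k)" for x k
  proof -
    have x2: "x\<^sup>2 \<le> (cmod (\<phi> k))\<^sup>2" using x abs_le_square_iff[of x "cmod (\<phi> k)"] by simp
    show ?thesis
    proof (cases "k = 0")
      case True then show ?thesis using x2 by simp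
    next
      case False
      then have "1 \<le> \<bar>of_int k :: real\<bar>" by linarith
      then have "1 \<le> (of_int k :: real)\<^sup>2" using power_mono[of 1 "\<bar>of_int k :: real\<bar>" 2] by simp
      then have "(1 + (of_int k)\<^sup>2) * x\<^sup>2 \<le> (2 * (of_int k)\<^sup>2) * (cmod (\<phi> k))\<^sup>2"
        using x2 by (intro mult_mono) auto
      then show ?thesis using False by simp
    qed
  qed
  show "(\<lambda>k. Re (\<phi> k)) \<in> form_dom" "(\<lambda>k. Im (\<phi> k)) \<in> form_dom"
    unfolding form_dom_def mem_Collect_eq
    by (rule summable_on_comparison_test[OF s b], rule abs_Re_le_cmod abs_Im_le_cmod, simp)+
qed

definition cmass :: "(int \<Rightarrow> complex) \<Rightarrow> real" where
  "cmass \<phi> = mass (\<lambda>k. Re (\<phi> k)) + mass (\<lambda>k. Im (\<phi> k))"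

definition cform :: "real \<Rightarrow> (int \<Rightarrow> complex) \<Rightarrow> real" where
  "cform s \<phi> = form s (\<lambda>k. Re (\<phi> k)) + form s (\<lambda>k. Im (\<phi> k))"

context
  fixes \<phi> :: "int \<Rightarrow> complex"
  assumes fin: "(\<lambda>k. (of_int k)\<^sup>2 * (cmod (\<phi> k))\<^sup>2) summable_on (UNIV :: int set)"
begin

lemmas dom = complex_form_dom[OF fin]

lemma energy_imp_abs_summable: "(\<lambda>k. norm (\<phi> k)) summable_on UNIV"
proof (rule Infinite_Sum.abs_summable_on_comparison_test')
  show "(\<lambda>k. norm (Re (\<phi> k)) + norm (Im (\<phi> k))) summable_on UNIV"
    by (intro summable_on_add form_dom_abs_summable dom)
qed (simp add: cmod_le)

lemma cmass_eq: "(\<Sum>\<^sub>\<infinity>k. (cmod (\<phi> k))\<^sup>2) = cmass \<phi>"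
  unfolding cmass_def mass_def cmod_power2 by (rule infsum_add) (intro form_domD dom)+

lemma cenergy_eq:
  "(\<Sum>\<^sub>\<infinity>k. (of_int k)\<^sup>2 * (cmod (\<phi> k))\<^sup>2) = energy (\<lambda>k. Re (\<phi> k)) + energy (\<lambda>k. Im (\<phi> k))"
  unfolding energy_def cmod_power2 distrib_left by (rule infsum_add) (intro form_domD dom)+

lemma cform_eq: "cform s \<phi> = cform 0 \<phi> + s * (\<Sum>\<^sub>\<infinity>k. (of_int k)\<^sup>2 * (cmod (\<phi> k))\<^sup>2)"
  by (simp add: cform_def form_def cenergy_eq algebra_simps)

lemma parseval: "integral\<^sup>L circle (\<lambda>\<theta>. (cmod (fseries \<phi> \<theta>))\<^sup>2) / (2 * pi) = cmass \<phi>"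
proof -
  have "(\<Sum>\<^sub>\<infinity>k. 2 * pi * (cmod (\<phi> k))\<^sup>2) = integral\<^sup>L circle (\<lambda>\<theta>. (cmod (fseries \<phi> \<theta>))\<^sup>2)"
    using fseries_square_has_sum[OF energy_imp_abs_summable] by (rule infsumI)
  then show ?thesis by (simp add: infsum_cmult_right' cmass_eq[symmetric] field_simps)
qed

lemma parseval_cos:
  "integral\<^sup>L circle (\<lambda>\<theta>. cos \<theta> * (cmod (fseries \<phi> \<theta>))\<^sup>2) / (2 * pi)
    = hop (\<lambda>k. Re (\<phi> k)) + hop (\<lambda>k. Im (\<phi> k))"
proof -
  have left: "((\<lambda>k. u k * u (k - 1)) has_sum hop u) UNIV" if "u \<in> form_dom" for u
    using form_dom_hop_summable[OF that] summable_on_shift_int[of "\<lambda>k. u k * u (k + 1)" "-1"]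
    by (simp add: has_sum_iff hop_def mult.commute)
  have right: "((\<lambda>k. u k * u (k + 1)) has_sum hop u) UNIV" if "u \<in> form_dom" for u
    using form_dom_hop_summable[OF that] by (simp add: has_sum_iff hop_def)
  let ?u = "\<lambda>k. Re (\<phi> k)" and ?v = "\<lambda>k. Im (\<phi> k)"
  have "((\<lambda>k. pi * ((?u k * ?u (k + 1) + ?v k * ?v (k + 1)) + (?u k * ?u (k - 1) + ?v k * ?v (k - 1)))) has_sum
      pi * ((hop ?u + hop ?v) + (hop ?u + hop ?v))) UNIV"
    by (intro has_sum_cmult_right has_sum_add left right dom)
  moreover have "pi * ((?u k * ?u (k + 1) + ?v k * ?v (k + 1)) + (?u k * ?u (k - 1) + ?v k * ?v (k - 1)))
      = pi * Re (\<phi> k * cnj (\<phi> (k + 1)) + \<phi> k * cnj (\<phi> (k - 1)))" for k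
    by simp
  ultimately have "integral\<^sup>L circle (\<lambda>\<theta>. cos \<theta> * (cmod (fseries \<phi> \<theta>))\<^sup>2)
      = pi * ((hop ?u + hop ?v) + (hop ?u + hop ?v))"
    using fseries_cos_has_sum[OF energy_imp_abs_summable] has_sum_unique by (simp only:) blast
  then show ?thesis by simp
qed

lemma integral_error_fseries:
  "integral\<^sup>L circle (\<lambda>\<theta>. (1 - cos \<theta>) * (cmod (fseries \<phi> \<theta>))\<^sup>2) / (2 * pi) = cform 0 \<phi>"
proof -
  interpret finite_measure circle by (rule finite_measure_circle)
  let ?F = "fseries \<phi>" and ?B = "\<Sum>\<^sub>\<infinity>k. norm (\<phi> k)"
  have [measurable]: "?F \<in> borel_measurable circle"
    by (intro measurable_circle_borel fseries_measurable energy_imp_abs_summable)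
  have [measurable]: "(\<lambda>\<theta>. cos \<theta>) \<in> borel_measurable circle"
    by (intro continuous_measurable_circle continuous_intros)
  have F2: "(cmod (?F \<theta>))\<^sup>2 \<le> ?B\<^sup>2" for \<theta>
    using norm_fseries_le[OF energy_imp_abs_summable] by (intro power_mono) auto
  have i1: "integrable circle (\<lambda>\<theta>. (cmod (?F \<theta>))\<^sup>2)"
    by (rule integrable_const_bound[where B = "?B\<^sup>2"]) (use F2 in auto)
  have "\<bar>cos \<theta>\<bar> * (cmod (?F \<theta>))\<^sup>2 \<le> 1 * ?B\<^sup>2" for \<theta>
    using F2 by (intro mult_mono) auto
  then have i2: "integrable circle (\<lambda>\<theta>. cos \<theta> * (cmod (?F \<theta>))\<^sup>2)"
    by (intro integrable_const_bound[where B = "?B\<^sup>2"]) (auto simp: abs_mult)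
  have "integral\<^sup>L circle (\<lambda>\<theta>. (1 - cos \<theta>) * (cmod (?F \<theta>))\<^sup>2)
      = integral\<^sup>L circle (\<lambda>\<theta>. (cmod (?F \<theta>))\<^sup>2) - integral\<^sup>L circle (\<lambda>\<theta>. cos \<theta> * (cmod (?F \<theta>))\<^sup>2)"
    by (simp add: left_diff_distrib Bochner_Integration.integral_diff i1 i2)
  then show ?thesis
    using parseval parseval_cos by (simp add: diff_divide_distrib cform_def form_def cmass_def)
qed

end

text \<open>The opposite sign convention amounts to reflecting the indices, which changes neither
  mass nor energy.\<close>

lemma Finv_eq_fseries: "Finv \<phi> \<theta> = fseries (\<lambda>k. \<phi> (- k)) \<theta>"
proof -
  have "Finv \<phi> \<theta> = (\<Sum>\<^sub>\<infinity>k. (\<lambda>k. \<phi> (- k) * cis (of_int k * \<theta>)) (- k))"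
    unfolding Finv_def by (rule infsum_cong) (simp add: cis_conv_exp mult.commute mult.left_commute)
  also have "\<dots> = fseries (\<lambda>k. \<phi> (- k)) \<theta>"
    unfolding fseries_def by (rule summable_on_uminus_int(2))
  finally show ?thesis .
qed

subsection \<open>The Mathieu equation\<close>

text \<open>The bare recurrence: for coefficients of a Mathieu solution finite energy is deduced
  from it afterwards.\<close>

definition complex_eigenseq :: "real \<Rightarrow> real \<Rightarrow> (int \<Rightarrow> complex) \<Rightarrow> bool" where
  "complex_eigenseq s l \<phi> \<longleftrightarrow>
     (\<forall>k. of_real (s * (of_int k)\<^sup>2 + 1 - l) * \<phi> k = (\<phi> (k + 1) + \<phi> (k - 1)) / 2)"

lemma complex_eigenseq_parts:
  assumes "complex_eigenseq s l \<phi>" "(\<lambda>k. (of_int k)\<^sup>2 * (cmod (\<phi> k))\<^sup>2) summable_on (UNIV :: int set)"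
  shows "eigenseq s l (\<lambda>k. Re (\<phi> k))" "eigenseq s l (\<lambda>k. Im (\<phi> k))"
proof -
  have rec: "of_real (s * (of_int k)\<^sup>2 + 1 - l) * \<phi> k = (\<phi> (k + 1) + \<phi> (k - 1)) / 2" for k
    using assms(1) by (simp only: complex_eigenseq_def)
  have "(s * (of_int k)\<^sup>2 + 1 - l) * Re (\<phi> k) = (Re (\<phi> (k + 1)) + Re (\<phi> (k - 1))) / 2" for k
    using arg_cong[OF rec[of k], of Re] by simp
  moreover have "(s * (of_int k)\<^sup>2 + 1 - l) * Im (\<phi> k) = (Im (\<phi> (k + 1)) + Im (\<phi> (k - 1))) / 2" for k
    using arg_cong[OF rec[of k], of Im] by simp
  ultimately show "eigenseq s l (\<lambda>k. Re (\<phi> k))" "eigenseq s l (\<lambda>k. Im (\<phi> k))"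
    using complex_form_dom[OF assms(2)] by (simp_all add: eigenseq_def algebra_simps)
qed

lemma periodic_add_of_int:
  fixes f :: "real \<Rightarrow> 'a"
  assumes "\<And>x. f (x + c) = f x"
  shows "f (x + of_int m * c) = f x"
proof (induction m rule: int_induct[where k = 0])
  case base show ?case by simp
next
  case (step1 i)
  have "f (x + of_int (i + 1) * c) = f (x + of_int i * c + c)" by (simp add: algebra_simps)
  then show ?case using assms step1 by simp
next
  case (step2 i)
  have "f (x + of_int i * c) = f (x + of_int (i - 1) * c + c)" by (simp add: algebra_simps)
  then show ?case using assms step2 by simp
qed

text \<open>A nonempty open set is not null, so f vanishes on the open interval; continuity adds the
  endpoints and periodicity the rest of the line.\<close>

lemma periodic_continuous_AE_zero:
  fixes f :: "real \<Rightarrow> complex"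
  assumes cont: "continuous_on UNIV f" and per: "\<And>x. f (x + 2 * pi) = f x"
    and ae: "AE \<theta> in circle. f \<theta> = 0"
  shows "f x = 0"
proof -
  define S where "S = {\<theta>. f \<theta> \<noteq> 0} \<inter> {-pi<..<pi}"
  have "open {\<theta>. f \<theta> \<noteq> 0}"
    using open_Collect_neq[OF cont continuous_on_const] by simp
  then have "open S" unfolding S_def by (rule open_Int) simp
  have "AE \<theta> in lborel. \<theta> \<in> {-pi<..pi} \<longrightarrow> f \<theta> = 0"
    using ae unfolding circle_def by (subst (asm) AE_restrict_space_iff) auto
  then have "AE \<theta> in lborel. \<theta> \<notin> S"
    by (rule AE_mp) (auto simp: S_def intro!: AE_I2)
  then have "S \<in> null_sets lborel"
    using \<open>open S\<close> by (subst AE_iff_null_sets) auto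
  then have "negligible S"
    by (simp add: negligible_iff_null_sets null_sets_completionI)
  then have "S = {}"
    using open_not_negligible[OF \<open>open S\<close>] by blast
  then have "{-pi<..<pi} \<subseteq> {\<theta>. f \<theta> = 0}" by (auto simp: S_def)
  moreover have "closed {\<theta>. f \<theta> = 0}"
    using closed_Collect_eq[OF cont continuous_on_const] by simp
  ultimately have "closure {-pi<..<pi} \<subseteq> {\<theta>. f \<theta> = 0}"
    by (rule closure_minimal)
  then have zero: "f \<theta> = 0" if "- pi \<le> \<theta>" "\<theta> \<le> pi" for \<theta>
    using that by auto
  define m where "m = \<lfloor>(x + pi) / (2 * pi)\<rfloor>"
  have "of_int m \<le> (x + pi) / (2 * pi)" "(x + pi) / (2 * pi) < of_int m + 1"
    unfolding m_def by linarith+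
  then have "f (x + of_int (- m) * (2 * pi)) = 0"
    by (intro zero) (simp_all add: field_simps)
  then show ?thesis
    using periodic_add_of_int[of f "2 * pi" x "- m", OF per] by simp
qed

text \<open>With q = -2/s and \<psi>(\<theta>) = y(\<theta>/2), Mathieu's equation becomes the eigenvalue equation
  (1 - cos \<theta>) \<psi> - s \<psi>'' = l \<psi>, where l = s a / 4 + 1.\<close>
lemma mathieu_fourier_coeff:
  assumes s: "s > 0" and y: "mathieu_eigfun (- 2 / s) a y"
  defines "\<phi> \<equiv> fourier_coeff (\<lambda>\<theta>. of_real (y (\<theta> / 2)))"
  shows "complex_eigenseq s (s * a / 4 + 1) \<phi>"
    and "(\<lambda>k. (of_int k)\<^sup>2 * (cmod (\<phi> k))\<^sup>2) summable_on (UNIV :: int set)"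
    and "\<exists>k. \<phi> k \<noteq> 0"
proof -
  define l where "l = s * a / 4 + 1"
  define \<psi> where "\<psi> \<theta> = complex_of_real (y (\<theta> / 2))" for \<theta>
  obtain y' y'' where nz: "\<exists>x. y x \<noteq> 0" and per: "\<And>x. y (x + pi) = y x"
    and d1: "\<And>x. (y has_real_derivative y' x) (at x)"
    and d2: "\<And>x. (y' has_real_derivative y'' x) (at x)"
    and ode: "\<And>x. y'' x + (a - 2 * (- 2 / s) * cos (2 * x)) * y x = 0"
    using y unfolding mathieu_eigfun_def by auto
  have cont_y: "continuous_on UNIV y"
    using d1 by (intro DERIV_continuous_on) auto
  have cont: "continuous_on UNIV \<psi>"
    unfolding \<psi>_def by (intro continuous_on_of_real continuous_on_compose2[OF cont_y] continuous_intros) auto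
  have per': "y' (x + pi) = y' x" for x
  proof -
    have "((\<lambda>x. y (x + pi)) has_real_derivative y' (x + pi)) (at x)"
      using d1[of "x + pi"] by (simp only: DERIV_shift)
    then have "(y has_real_derivative y' (x + pi)) (at x)" by (simp add: per)
    then show ?thesis using d1 DERIV_unique by blast
  qed
  interpret finite_measure circle by (rule finite_measure_circle)
  have "bounded (\<psi> ` {-pi..pi})"
    by (intro compact_imp_bounded compact_continuous_image continuous_on_subset[OF cont]) auto
  then obtain B where B: "\<And>\<theta>. \<theta> \<in> {-pi..pi} \<Longrightarrow> norm (\<psi> \<theta>) \<le> B"
    unfolding bounded_iff by (metis imageI)
  have int: "integrable circle \<psi>"
    by (rule integrable_const_bound[where B = B])
       (use B in \<open>auto intro!: AE_I2 continuous_measurable_circle cont\<close>)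
  have moment: "integral\<^sup>L circle (\<lambda>\<theta>. cis (of_int (- k) * \<theta>) * \<psi> \<theta>) = 2 * pi * \<phi> k" for k
    by (simp add: \<phi>_def \<psi>_def fourier_coeff_circle)
  have rec: "of_real (s * (of_int k)\<^sup>2 + 1 - l) * \<phi> k = (\<phi> (k + 1) + \<phi> (k - 1)) / 2" for k
  proof -
    define w where "w = complex_of_real (s * (of_int k)\<^sup>2 + 1 - l)"
    define g where "g \<theta> = w * (cis (of_int (- k) * \<theta>) * \<psi> \<theta>)
      - (1/2 * (cis (of_int (- (k + 1)) * \<theta>) * \<psi> \<theta>) + 1/2 * (cis (of_int (- (k - 1)) * \<theta>) * \<psi> \<theta>))" for \<theta>
    \<comment> \<open>G is s cis(-k\<theta>) (\<psi>' + i k \<psi>), with derivative s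
      cis(-k\<theta>) (\<psi>'' + k^2 \<psi>): two integrations by parts in one antiderivative. By
      Mathieu's equation that derivative is g.\<close>
    define G where "G \<theta> = of_real s * (cis (of_int (- k) * \<theta>) *
      (of_real (y' (\<theta> / 2) / 2) + \<i> * of_int k * of_real (y (\<theta> / 2))))" for \<theta>
    have g_eq: "g \<theta> = cis (of_int (- k) * \<theta>) * of_real ((s * (of_int k)\<^sup>2 + 1 - l - cos \<theta>) * y (\<theta> / 2))" for \<theta>
    proof -
      have "complex_of_real (cos \<theta>) = (cis \<theta> + cis (- \<theta>)) / 2"
        by (simp add: complex_eq_iff)
      moreover have "cis (of_int (- (k + 1)) * \<theta>) = cis (of_int (- k) * \<theta>) * cis (- \<theta>)"
        "cis (of_int (- (k - 1)) * \<theta>) = cis (of_int (- k) * \<theta>) * cis \<theta>"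
        by (simp_all add: cis_mult algebra_simps)
      ultimately show ?thesis
        by (simp only: g_def w_def \<psi>_def of_real_mult of_real_diff) (simp add: algebra_simps add_divide_distrib)
    qed
    have "integral\<^sup>L circle g = G pi - G (- pi)"
    proof (rule circle_FTC)
      fix x
      have half: "((\<lambda>\<theta>. \<theta> / 2) has_real_derivative 1 / 2) (at x)"
        by (auto intro!: derivative_eq_intros)
      have dy: "((\<lambda>\<theta>. y (\<theta> / 2)) has_real_derivative y' (x / 2) / 2) (at x)"
        using DERIV_chain2[OF d1 half] by simp
      have dy': "((\<lambda>\<theta>. y' (\<theta> / 2) / 2) has_real_derivative y'' (x / 2) / 4) (at x)"
        using DERIV_cdivide[OF DERIV_chain2[OF d2 half], of 2] by simp
      have dc: "((\<lambda>\<theta>. cis (of_int (- k) * \<theta>)) has_vector_derivative (- (\<i> * of_int k) * cis (of_int (- k) * x))) (at x)"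
        by (auto intro!: derivative_eq_intros simp: has_vector_derivative_def scaleR_conv_of_real)
      have "((\<lambda>\<theta>. of_real (y' (\<theta> / 2) / 2) + \<i> * of_int k * of_real (y (\<theta> / 2))) has_vector_derivative
          of_real (y'' (x / 2) / 4) + \<i> * of_int k * of_real (y' (x / 2) / 2)) (at x)"
        by (intro has_vector_derivative_add has_vector_derivative_mult_right has_vector_derivative_of_real dy dy')
      from has_vector_derivative_mult_right[OF has_vector_derivative_mult[OF dc this], of "of_real s"]
      have "(G has_vector_derivative of_real s *
          (cis (of_int (- k) * x) * (of_real (y'' (x / 2) / 4) + \<i> * of_int k * of_real (y' (x / 2) / 2))
           + - (\<i> * of_int k) * cis (of_int (- k) * x) * (of_real (y' (x / 2) / 2) + \<i> * of_int k * of_real (y (x / 2))))) (at x)"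
        unfolding G_def .
      moreover have "s * y'' (x / 2) / 4 = (1 - l - cos x) * y (x / 2)"
        using ode[of "x / 2"] s by (simp add: l_def field_simps)
      then have "complex_of_real s * of_real (y'' (x / 2) / 4) = of_real ((1 - l - cos x) * y (x / 2))"
        by (metis of_real_mult times_divide_eq_right)
      then have "complex_of_real s *
          (cis (of_int (- k) * x) * (of_real (y'' (x / 2) / 4) + \<i> * of_int k * of_real (y' (x / 2) / 2))
           + - (\<i> * of_int k) * cis (of_int (- k) * x) * (of_real (y' (x / 2) / 2) + \<i> * of_int k * of_real (y (x / 2))))
          = g x"
      proof -
        assume e: "complex_of_real s * of_real (y'' (x / 2) / 4) = of_real ((1 - l - cos x) * y (x / 2))"
        let ?c = "cis (of_int (- k) * x)" and ?K = "complex_of_int k" and ?S = "complex_of_real s"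
        let ?D = "complex_of_real (y'' (x / 2) / 4)" and ?P = "complex_of_real (y' (x / 2) / 2)"
        let ?Y = "complex_of_real (y (x / 2))"
        have expand: "S * (c * (D + I * K * P) + - (I * K) * c * (P + I * K * Y)) = c * (S * D) - (I * I) * (c * S * K * K * Y)"
          for S c D I K P Y :: complex
          by (simp add: algebra_simps)
        have "?S * (?c * (?D + \<i> * ?K * ?P) + - (\<i> * ?K) * ?c * (?P + \<i> * ?K * ?Y))
            = ?c * (?S * ?D) - (\<i> * \<i>) * (?c * ?S * ?K * ?K * ?Y)"
          by (rule expand)
        also have "\<dots> = ?c * (?S * ?D + ?S * ?K\<^sup>2 * ?Y)"
          by (simp add: algebra_simps power2_eq_square)
        also have "\<dots> = g x"
          unfolding e g_eq by (simp add: algebra_simps)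
        finally show ?thesis .
      qed
      ultimately show "(G has_vector_derivative g x) (at x)" by simp
    next
      show "continuous_on UNIV g"
        unfolding g_def by (intro continuous_intros cont)
    qed
    \<comment> \<open>Period \<open>pi\<close> of y and y' is period 2 pi in \<theta>, so there is
      no boundary term.\<close>
    also have "G pi = G (- pi)"
      using per[of "- pi / 2"] per'[of "- pi / 2"] cis_of_int_mult_pi[of "- k"] by (simp add: G_def)
    finally have "integral\<^sup>L circle g = 0" by simp
    moreover have "integral\<^sup>L circle g = w * (2 * pi * \<phi> k)
        - (1/2 * (2 * pi * \<phi> (k + 1)) + 1/2 * (2 * pi * \<phi> (k - 1)))"
    proof -
      have i: "integrable circle (\<lambda>\<theta>. c * (cis (of_int m * \<theta>) * \<psi> \<theta>))" for c m
        using integrable_cis_mult[OF int] by (rule integrable_mult_right)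
      show ?thesis
        unfolding g_def Bochner_Integration.integral_diff[OF i Bochner_Integration.integrable_add[OF i i]]
          Bochner_Integration.integral_add[OF i i]
        by (simp only: integral_mult_right_zero moment)
    qed
    moreover have "w * (2 * pi * \<phi> k) - (1/2 * (2 * pi * \<phi> (k + 1)) + 1/2 * (2 * pi * \<phi> (k - 1)))
        = 2 * pi * (w * \<phi> k - (\<phi> (k + 1) + \<phi> (k - 1)) / 2)"
      by (simp add: algebra_simps add_divide_distrib)
    ultimately have "2 * pi * (w * \<phi> k - (\<phi> (k + 1) + \<phi> (k - 1)) / 2) = 0"
      by (simp only:)
    then show ?thesis by (simp add: w_def)
  qed
  then show "complex_eigenseq s (s * a / 4 + 1) \<phi>"
    unfolding complex_eigenseq_def l_def by (rule allI)

  \<comment> \<open>The L^1 norm bounds all coefficients alike; solving the recurrence for k^2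
    \<phi>(k) then improves this to decay D / (1 + k^2), enough for finite energy.\<close>
  define b where "b = integral\<^sup>L circle (\<lambda>\<theta>. norm (\<psi> \<theta>)) / (2 * pi)"
  have b: "norm (\<phi> k) \<le> b" for k
  proof -
    have "norm (2 * pi * \<phi> k) \<le> integral\<^sup>L circle (\<lambda>\<theta>. norm (cis (of_int (- k) * \<theta>) * \<psi> \<theta>))"
      unfolding moment[symmetric] by (rule integral_norm_bound)
    then show ?thesis by (simp add: b_def norm_mult field_simps)
  qed
  define D where "D = b + (b + \<bar>1 - l\<bar> * b) / s"
  have k2: "(1 + (of_int k)\<^sup>2) * norm (\<phi> k) \<le> D" for k
  proof -
    have "of_real (s * (of_int k)\<^sup>2) * \<phi> k = (\<phi> (k + 1) + \<phi> (k - 1)) / 2 - of_real (1 - l) * \<phi> k"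
      unfolding rec[symmetric] by (simp add: algebra_simps)
    then have "s * (of_int k)\<^sup>2 * norm (\<phi> k) = norm ((\<phi> (k + 1) + \<phi> (k - 1)) / 2 - of_real (1 - l) * \<phi> k)"
      using s by (metis abs_of_nonneg less_imp_le mult_nonneg_nonneg norm_mult norm_of_real zero_le_power2)
    also have "\<dots> \<le> norm ((\<phi> (k + 1) + \<phi> (k - 1)) / 2) + norm (of_real (1 - l) * \<phi> k)"
      by (rule norm_triangle_ineq4)
    also have "norm ((\<phi> (k + 1) + \<phi> (k - 1)) / 2) \<le> b"
      using norm_triangle_ineq[of "\<phi> (k + 1)" "\<phi> (k - 1)"] b[of "k + 1"] b[of "k - 1"]
      by (simp add: norm_divide)
    also have "norm (of_real (1 - l) * \<phi> k) \<le> \<bar>1 - l\<bar> * b"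
      unfolding norm_mult norm_of_real by (intro mult_left_mono b) auto
    finally have "(of_int k)\<^sup>2 * norm (\<phi> k) \<le> (b + \<bar>1 - l\<bar> * b) / s"
      using s by (simp add: field_simps)
    then show ?thesis
      using b[of k] by (simp add: D_def algebra_simps)
  qed
  show "(\<lambda>k. (of_int k)\<^sup>2 * (cmod (\<phi> k))\<^sup>2) summable_on (UNIV :: int set)"
  proof (rule summable_on_comparison_test)
    show "(\<lambda>k. D\<^sup>2 * (1 / (1 + (of_int k)\<^sup>2))) summable_on (UNIV :: int set)"
      by (intro summable_on_cmult_right summable_on_int_weight)
    fix k :: int
    let ?w = "1 + (of_int k)\<^sup>2 :: real"
    have w: "?w > 0" by (simp add: add_pos_nonneg)
    have "(of_int k)\<^sup>2 * (cmod (\<phi> k))\<^sup>2 \<le> ?w * (cmod (\<phi> k))\<^sup>2"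
      by (intro mult_right_mono) auto
    also have "\<dots> = (?w * cmod (\<phi> k))\<^sup>2 * (1 / ?w)"
      using w by (simp add: power2_eq_square)
    also have "\<dots> \<le> D\<^sup>2 * (1 / ?w)"
      using w k2[of k] by (intro mult_right_mono power_mono) auto
    finally show "(of_int k)\<^sup>2 * (cmod (\<phi> k))\<^sup>2 \<le> D\<^sup>2 * (1 / ?w)" .
  qed simp

  \<comment> \<open>If all coefficients vanished, completeness would give \<psi> = 0 almost
    everywhere, and continuity everywhere.\<close>
  show "\<exists>k. \<phi> k \<noteq> 0"
  proof (rule ccontr)
    assume "\<not> (\<exists>k. \<phi> k \<noteq> 0)"
    then have zero: "fourier_coeff \<psi> = (\<lambda>_. 0)"
      by (auto simp: \<phi>_def \<psi>_def[abs_def])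
    have "AE \<theta> in circle. \<psi> \<theta> = fseries (fourier_coeff \<psi>) \<theta>"
      by (rule AE_eq_fseries[OF int]) (simp add: zero)
    then have ae: "AE \<theta> in circle. \<psi> \<theta> = 0"
      by (simp add: zero fseries_def)
    have "\<psi> (x + 2 * pi) = \<psi> x" for x
      using per[of "x / 2"] by (simp add: \<psi>_def add_divide_distrib)
    then have "\<psi> x = 0" for x
      by (rule periodic_continuous_AE_zero[OF cont _ ae])
    then have "y x = 0" for x
      using \<psi>_def[of "2 * x"] by simp
    then show False using nz by simp
  qed
qed

text \<open>Conversely, the cosine series of an even solution of the recurrence converges together with
  its second derivative, since the recurrence makes k^2 u(k) absolutely summable.\<close>
lemma eigenseq_mathieu:
  assumes s: "s > 0" and u: "eigenseq s l u" and even: "\<And>k. u (- k) = u k" and "mass u \<noteq> 0"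
  obtains y where "mathieu_eigfun (- 2 / s) (4 * (l - 1) / s) y"
    "\<And>\<theta>. fseries (\<lambda>k. of_real (u k)) \<theta> = of_real (y (\<theta> / 2))"
proof -
  have uD: "u \<in> form_dom"
    and rec: "\<And>k. s * (of_int k)\<^sup>2 * u k + (1 - l) * u k = (u (k + 1) + u (k - 1)) / 2"
    using u by (auto simp: eigenseq_def)
  have us: "(\<lambda>k. norm (u k)) summable_on UNIV" by (rule form_dom_abs_summable[OF uD])
  have su: "(\<lambda>k. u k * cos (c k)) summable_on UNIV" for c
    by (rule abs_summable_summable, rule Infinite_Sum.abs_summable_on_comparison_test'[OF us])
       (simp add: abs_mult mult_left_le)
  define v where "v k = (of_int k)\<^sup>2 * u k" for k :: int
  have v_eq: "v = (\<lambda>k. (u (k + 1) * (1/2) + u (k + (- 1)) * (1/2) + (l - 1) * u k) * (1 / s))"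
  proof
    fix k
    have "s * v k = u (k + 1) * (1/2) + u (k + (- 1)) * (1/2) + (l - 1) * u k"
      using rec[of k] by (simp add: v_def algebra_simps)
    then show "v k = (u (k + 1) * (1/2) + u (k + (- 1)) * (1/2) + (l - 1) * u k) * (1 / s)"
      using s by (simp add: field_simps)
  qed
  have vs: "(\<lambda>k. norm (v k)) summable_on UNIV"
  proof -
    have us': "u summable_on UNIV" using us by (rule abs_summable_summable)
    have "v summable_on UNIV"
      unfolding v_eq
      by (intro summable_on_cmult_left summable_on_cmult_right summable_on_add summable_on_shift_int(1)[THEN iffD2] us')
    then show ?thesis
      by (rule summable_on_iff_abs_summable_on_real[THEN iffD1])
  qed
  have sv: "(\<lambda>k. v k * cos (c k)) summable_on UNIV" for c
    by (rule abs_summable_summable, rule Infinite_Sum.abs_summable_on_comparison_test'[OF vs])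
       (simp add: abs_mult mult_left_le)
  define d :: "nat \<Rightarrow> real" where "d n = of_int (int_decode n)" for n
  define c where "c n = u (int_decode n)" for n
  define y where "y x = (\<Sum>n. c n * cos (2 * d n * x))" for x
  define y' where "y' x = (\<Sum>n. - (2 * d n * c n * sin (2 * d n * x)))" for x
  define y'' where "y'' x = (\<Sum>n. - (4 * ((d n)\<^sup>2 * c n) * cos (2 * d n * x)))" for x
  have y_inf: "y x = (\<Sum>\<^sub>\<infinity>k. u k * cos (2 * of_int k * x))" for x
    using has_sum_imp_sums_int_decode[OF has_sum_infsum[OF su[of "\<lambda>k. 2 * of_int k * x"]]]
    by (simp add: y_def c_def d_def sums_iff)
  have y''_inf: "y'' x = (\<Sum>\<^sub>\<infinity>k. v k * cos (2 * of_int k * x)) * (- 4)" for x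
    using sums_mult2[OF has_sum_imp_sums_int_decode[OF has_sum_infsum[OF sv[of "\<lambda>k. 2 * of_int k * x"]]], of "- 4"]
    by (simp add: y''_def c_def d_def v_def sums_iff mult_ac)
  have cs: "summable (\<lambda>n. norm (c n))"
    using summable_on_imp_summable_int_decode[OF us] by (simp add: c_def)
  have vs': "summable (\<lambda>n. (d n)\<^sup>2 * norm (c n))"
    using summable_on_imp_summable_int_decode[OF vs] by (simp add: c_def d_def v_def abs_mult)
  \<comment> \<open>The frequencies are integers, so the majorant for the second derivative also
    covers the first.\<close>
  have dv: "\<bar>d n\<bar> \<le> (d n)\<^sup>2" for n
  proof (cases "int_decode n = 0")
    case False
    then have "1 \<le> \<bar>d n\<bar>" unfolding d_def by linarith
    then have "\<bar>d n\<bar> * 1 \<le> \<bar>d n\<bar> * \<bar>d n\<bar>" by (intro mult_left_mono) auto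
    then show ?thesis by (simp add: power2_eq_square flip: abs_mult)
  qed (simp add: d_def)
  have cs': "summable (\<lambda>n. c n * cos (2 * d n * 0))"
    using cs by (simp add: summable_rabs_cancel)
  have ds: "summable (\<lambda>n. - (2 * d n * c n * sin (2 * d n * 0)))" by simp
  have dy: "(y has_real_derivative y' x) (at x)" for x
    unfolding y_def y'_def
  proof (rule has_field_derivative_series'(2)[of UNIV "\<lambda>n x. c n * cos (2 * d n * x)"
        "\<lambda>n x. - (2 * d n * c n * sin (2 * d n * x))" 0])
    show "summable (\<lambda>n. c n * cos (2 * d n * 0))" by (rule cs')
  next
    show "uniformly_convergent_on UNIV (\<lambda>n x. \<Sum>i<n. - (2 * d i * c i * sin (2 * d i * x)))"
    proof (rule Weierstrass_m_test')
      show "summable (\<lambda>n. 2 * ((d n)\<^sup>2 * norm (c n)))" by (rule summable_mult[OF vs'])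
      fix n and x :: real
      have "\<bar>d n\<bar> * \<bar>c n\<bar> * \<bar>sin (2 * d n * x)\<bar> \<le> (d n)\<^sup>2 * \<bar>c n\<bar> * 1"
        using dv by (intro mult_mono) auto
      then show "norm (- (2 * d n * c n * sin (2 * d n * x))) \<le> 2 * ((d n)\<^sup>2 * norm (c n))"
        by (simp add: abs_mult)
    qed
  qed (auto intro!: derivative_eq_intros)
  have dy': "(y' has_real_derivative y'' x) (at x)" for x
    unfolding y'_def y''_def
  proof (rule has_field_derivative_series'(2)[of UNIV "\<lambda>n x. - (2 * d n * c n * sin (2 * d n * x))"
        "\<lambda>n x. - (4 * ((d n)\<^sup>2 * c n) * cos (2 * d n * x))" 0])
    show "summable (\<lambda>n. - (2 * d n * c n * sin (2 * d n * 0)))" by (rule ds)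
  next
    show "uniformly_convergent_on UNIV (\<lambda>n x. \<Sum>i<n. - (4 * ((d i)\<^sup>2 * c i) * cos (2 * d i * x)))"
    proof (rule Weierstrass_m_test')
      show "summable (\<lambda>n. 4 * ((d n)\<^sup>2 * norm (c n)))" by (rule summable_mult[OF vs'])
      fix n and x :: real
      have "(d n)\<^sup>2 * \<bar>c n\<bar> * \<bar>cos (2 * d n * x)\<bar> \<le> (d n)\<^sup>2 * \<bar>c n\<bar> * 1"
        by (intro mult_mono) auto
      then show "norm (- (4 * ((d n)\<^sup>2 * c n) * cos (2 * d n * x))) \<le> 4 * ((d n)\<^sup>2 * norm (c n))"
        by (simp add: abs_mult)
    qed
  qed (auto intro!: derivative_eq_intros simp: power2_eq_square)
  have ode: "y'' x + (4 * (l - 1) / s - 2 * (- 2 / s) * cos (2 * x)) * y x = 0" for x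
  proof -
    define e where "e k = cos (2 * of_int k * x)" for k :: int
    \<comment> \<open>Index shifts move from the coefficients to the cosines, where cos(2(k-1)x) +
      cos(2(k+1)x) = 2 cos(2x) cos(2kx) merges the neighbour sums.\<close>
    have esh: "u (k + m) * e k = (\<lambda>j. u j * cos (2 * of_int (j - m) * x)) (k + m)" for k m
      by (simp add: e_def)
    have sh: "(\<lambda>k. u (k + m) * e k) summable_on UNIV"
      "(\<Sum>\<^sub>\<infinity>k. u (k + m) * e k) = (\<Sum>\<^sub>\<infinity>k. u k * cos (2 * of_int (k - m) * x))" for m
      unfolding esh
      using summable_on_shift_int[of "\<lambda>j. u j * cos (2 * of_int (j - m) * x)" m] su by simp_all
    have s1: "(\<lambda>k. (u (k + 1) * e k) * (1/2)) summable_on UNIV"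
      "(\<lambda>k. (u (k + (- 1)) * e k) * (1/2)) summable_on UNIV"
      "(\<lambda>k. (l - 1) * (u k * e k)) summable_on UNIV"
      by (intro summable_on_cmult_left sh(1))+ (use sh(1)[of 0] in \<open>auto intro: summable_on_cmult_right\<close>)
    have "s * (\<Sum>\<^sub>\<infinity>k. v k * e k) = (\<Sum>\<^sub>\<infinity>k. s * (v k * e k))"
      by (simp add: infsum_cmult_right')
    also have "\<dots> = (\<Sum>\<^sub>\<infinity>k. (u (k + 1) * e k) * (1/2) + (u (k + (- 1)) * e k) * (1/2) + (l - 1) * (u k * e k))"
    proof (rule infsum_cong)
      fix k
      have "s * v k = u (k + 1) * (1/2) + u (k + (- 1)) * (1/2) + (l - 1) * u k"
        using rec[of k] by (simp add: v_def algebra_simps)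
      then have "s * v k * e k = (u (k + 1) * (1/2) + u (k + (- 1)) * (1/2) + (l - 1) * u k) * e k" by simp
      then show "s * (v k * e k) = (u (k + 1) * e k) * (1/2) + (u (k + (- 1)) * e k) * (1/2) + (l - 1) * (u k * e k)"
        by (simp add: algebra_simps)
    qed
    also have "\<dots> = (\<Sum>\<^sub>\<infinity>k. u (k + 1) * e k) * (1/2) + (\<Sum>\<^sub>\<infinity>k. u (k + (- 1)) * e k) * (1/2) + (l - 1) * y x"
      unfolding infsum_add[OF summable_on_add[OF s1(1,2)] s1(3)] infsum_add[OF s1(1,2)]
      by (simp only: infsum_cmult_left' infsum_cmult_right' y_inf e_def)
    also have "(\<Sum>\<^sub>\<infinity>k. u (k + 1) * e k) * (1/2) + (\<Sum>\<^sub>\<infinity>k. u (k + (- 1)) * e k) * (1/2) = cos (2 * x) * y x"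
    proof -
      have "cos (2 * of_int (k - 1) * x) + cos (2 * of_int (k - (- 1)) * x) = 2 * (cos (2 * x) * cos (2 * of_int k * x))" for k
        by (simp add: cos_add cos_diff algebra_simps)
      then have "u k * cos (2 * of_int (k - 1) * x) + u k * cos (2 * of_int (k - (- 1)) * x)
          = (2 * cos (2 * x)) * (u k * cos (2 * of_int k * x))" for k
        by (simp only: distrib_left[symmetric]) (simp only: mult_ac)
      then have "(\<Sum>\<^sub>\<infinity>k. u (k + 1) * e k) + (\<Sum>\<^sub>\<infinity>k. u (k + (- 1)) * e k) = (2 * cos (2 * x)) * y x"
        unfolding sh(2) infsum_add[OF su su, symmetric] y_inf infsum_cmult_right'[symmetric] by simp
      then show ?thesis by simp
    qed
    finally have "s * (\<Sum>\<^sub>\<infinity>k. v k * e k) = (cos (2 * x) + l - 1) * y x"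
      by (simp add: algebra_simps)
    moreover have "y'' x = (\<Sum>\<^sub>\<infinity>k. v k * e k) * (- 4)"
      by (simp only: y''_inf e_def)
    ultimately have "s * y'' x = - 4 * ((cos (2 * x) + l - 1) * y x)"
      by simp
    then have "y'' x = - 4 * ((cos (2 * x) + l - 1) * y x) / s"
      using s by (metis less_irrefl nonzero_mult_div_cancel_left)
    then show ?thesis by (simp add: divide_inverse algebra_simps)
  qed
  have fs: "fseries (\<lambda>k. of_real (u k)) \<theta> = of_real (y (\<theta> / 2))" for \<theta>
  proof -
    have hs: "((\<lambda>k. of_real (u k) * cis (of_int k * \<theta>)) has_sum fseries (\<lambda>k. of_real (u k)) \<theta>) UNIV"
      by (rule fseries_has_sum) (use us in simp)
    have "((\<lambda>k. u k * cos (of_int k * \<theta>)) has_sum Re (fseries (\<lambda>k. of_real (u k)) \<theta>)) UNIV"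
      using has_sum_Re[OF hs] by simp
    then have "Re (fseries (\<lambda>k. of_real (u k)) \<theta>) = y (\<theta> / 2)"
      unfolding y_inf by (simp add: infsumI)
    \<comment> \<open>Reflecting k changes the sign of the sine series because u is even.\<close>
    moreover have "Im (fseries (\<lambda>k. of_real (u k)) \<theta>) = 0"
    proof -
      have "((\<lambda>k. u k * sin (of_int k * \<theta>)) has_sum Im (fseries (\<lambda>k. of_real (u k)) \<theta>)) UNIV"
        using has_sum_Im[OF hs] by simp
      then have "Im (fseries (\<lambda>k. of_real (u k)) \<theta>) = (\<Sum>\<^sub>\<infinity>k. u k * sin (of_int k * \<theta>))"
        by (simp add: infsumI)
      moreover have "- (\<Sum>\<^sub>\<infinity>k. u k * sin (of_int k * \<theta>)) = (\<Sum>\<^sub>\<infinity>k. u k * sin (of_int k * \<theta>))"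
        using summable_on_uminus_int(2)[of "\<lambda>k. u k * sin (of_int k * \<theta>)"]
        by (simp only: even of_int_minus mult_minus_left sin_minus mult_minus_right infsum_uminus)
      ultimately show ?thesis by linarith
    qed
    ultimately show ?thesis by (simp add: complex_eq_iff)
  qed
  have "\<exists>x. y x \<noteq> 0"
  proof (rule ccontr)
    assume "\<not> (\<exists>x. y x \<noteq> 0)"
    then have "fseries (\<lambda>k. of_real (u k)) = (\<lambda>_. 0)" by (simp add: fs fun_eq_iff)
    then have "fourier_coeff (fseries (\<lambda>k. of_real (u k))) k = 0" for k
      by (simp add: fourier_coeff_def)
    moreover have "fourier_coeff (fseries (\<lambda>k. of_real (u k))) k = of_real (u k)" for k
      by (rule fourier_coeff_fseries) (use us in simp)
    ultimately have "u k = 0" for k by simp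
    then show False using \<open>mass u \<noteq> 0\<close> by (simp add: mass_def)
  qed
  moreover have "y (x + pi) = y x" for x
  proof -
    have "cos (2 * of_int k * (x + pi)) = cos (2 * of_int k * x)" for k :: int
    proof -
      have "2 * of_int k * (x + pi) = 2 * of_int k * x + 2 * pi * of_int k" by (simp add: algebra_simps)
      then show ?thesis by (simp add: cos_add)
    qed
    then show ?thesis by (simp only: y_inf)
  qed
  moreover have "y (- x) = y x" for x by (simp add: y_def)
  ultimately have "mathieu_eigfun (- 2 / s) (4 * (l - 1) / s) y"
    unfolding mathieu_eigfun_def using dy dy' ode by blast
  then show ?thesis using fs by (rule that)
qed

subsection \<open>The optimal error\<close>

text \<open>The shift by \<open>pi / 2\<close> flips the sign of cos(2x). Evenness survives because
  y(-x + pi/2) = y(x - pi/2) = y(x + pi/2) by evenness and period.\<close>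

lemma mathieu_eigfun_shift:
  assumes "mathieu_eigfun q a y"
  shows "mathieu_eigfun (- q) a (\<lambda>x. y (x + pi / 2))"
proof -
  obtain y' y'' where nz: "\<exists>x. y x \<noteq> 0" and per: "\<And>x. y (x + pi) = y x" and even: "\<And>x. y (- x) = y x"
    and d1: "\<And>x. (y has_real_derivative y' x) (at x)"
    and d2: "\<And>x. (y' has_real_derivative y'' x) (at x)"
    and ode: "\<And>x. y'' x + (a - 2 * q * cos (2 * x)) * y x = 0"
    using assms unfolding mathieu_eigfun_def by auto
  have "\<exists>x. y (x + pi / 2) \<noteq> 0"
    using nz by (metis diff_add_cancel)
  moreover have "y (x + pi + pi / 2) = y (x + pi / 2)" for x
    using per[of "x + pi / 2"] by (simp add: algebra_simps)
  moreover have "y (- x + pi / 2) = y (x + pi / 2)" for x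
    using even[of "x - pi / 2"] per[of "x - pi / 2"] by (simp add: add.commute)
  moreover have "((\<lambda>x. y (x + pi / 2)) has_real_derivative y' (x + pi / 2)) (at x)" for x
    using d1[of "x + pi / 2"] by (simp only: DERIV_shift)
  moreover have "((\<lambda>x. y' (x + pi / 2)) has_real_derivative y'' (x + pi / 2)) (at x)" for x
    using d2[of "x + pi / 2"] by (simp only: DERIV_shift)
  moreover have "y'' (x + pi / 2) + (a - 2 * (- q) * cos (2 * x)) * y (x + pi / 2) = 0" for x
    using ode[of "x + pi / 2"] by (simp add: distrib_left)
  ultimately show ?thesis
    unfolding mathieu_eigfun_def
    by (intro conjI allI exI[of _ "\<lambda>x. y' (x + pi / 2)"] exI[of _ "\<lambda>x. y'' (x + pi / 2)"])
qed

lemma a0_minus: "a0 (- q) = a0 q"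
proof -
  have "{a. \<exists>y. mathieu_eigfun (- q) a y} = {a. \<exists>y. mathieu_eigfun q a y}"
    using mathieu_eigfun_shift mathieu_eigfun_shift[of "- q"] by fastforce
  then show ?thesis by (simp add: a0_def)
qed

lemma ground_le_cform:
  assumes "s > 0" "(\<lambda>k. (of_int k)\<^sup>2 * (cmod (\<phi> k))\<^sup>2) summable_on (UNIV :: int set)"
  shows "ground s * cmass \<phi> \<le> cform s \<phi>"
  using ground_le_form[OF assms(1) complex_form_dom(1)[OF assms(2)]]
    ground_le_form[OF assms(1) complex_form_dom(2)[OF assms(2)]]
  by (simp add: cmass_def cform_def distrib_left)

lemma cmass_pos:
  assumes "(\<lambda>k. (of_int k)\<^sup>2 * (cmod (\<phi> k))\<^sup>2) summable_on (UNIV :: int set)" "\<phi> j \<noteq> 0"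
  shows "cmass \<phi> > 0"
proof -
  have "cmass \<phi> \<ge> 0"
    by (simp add: cmass_def mass_nonneg)
  moreover have "cmass \<phi> \<noteq> 0"
  proof
    assume "cmass \<phi> = 0"
    then have "mass (\<lambda>k. Re (\<phi> k)) = 0" "mass (\<lambda>k. Im (\<phi> k)) = 0"
      using mass_nonneg[of "\<lambda>k. Re (\<phi> k)"] mass_nonneg[of "\<lambda>k. Im (\<phi> k)"] by (simp_all add: cmass_def)
    then have "Re (\<phi> j) = 0" "Im (\<phi> j) = 0"
      using mass_eq_0D[OF complex_form_dom(1)[OF assms(1)]] mass_eq_0D[OF complex_form_dom(2)[OF assms(1)]]
      by (auto dest: fun_cong)
    then show False using assms(2) by (simp add: complex_eq_iff)
  qed
  ultimately show ?thesis by simp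
qed

lemma ground_state_exists:
  assumes "s > 0"
  obtains u where "eigenseq s (ground s) u" "mass u = 1"
proof -
  obtain u where "u \<in> form_dom" "mass u = 1" "form s u = ground s"
    using ground_attained[OF assms] by metis
  then show ?thesis using ground_state_eigenseq[OF assms, of u] that by simp
qed

text \<open>The ground state supplies a classical solution with this eigenvalue. Conversely, the
  coefficients of any classical solution have Rayleigh quotient s a / 4 + 1, which is at least
  \<open>ground s\<close>.\<close>

lemma a0_ground:
  assumes s: "s > 0"
  shows "a0 (- 2 / s) = 4 * (ground s - 1) / s"
  unfolding a0_def
proof (rule cInf_eq_minimum)
  obtain u where u: "eigenseq s (ground s) u" "mass u = 1"
    using ground_state_exists[OF s] by blast
  then obtain y where "mathieu_eigfun (- 2 / s) (4 * (ground s - 1) / s) y"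
    using eigenseq_mathieu[OF s u(1) ground_state_even[OF s u(1)]] by (metis zero_neq_one)
  then show "4 * (ground s - 1) / s \<in> {a. \<exists>y. mathieu_eigfun (- 2 / s) a y}" by blast
next
  fix a assume "a \<in> {a. \<exists>y. mathieu_eigfun (- 2 / s) a y}"
  then obtain y where y: "mathieu_eigfun (- 2 / s) a y" by blast
  define \<phi> where "\<phi> = fourier_coeff (\<lambda>\<theta>. of_real (y (\<theta> / 2)))"
  define l where "l = s * a / 4 + 1"
  have rec: "complex_eigenseq s l \<phi>"
    and fin: "(\<lambda>k. (of_int k)\<^sup>2 * (cmod (\<phi> k))\<^sup>2) summable_on (UNIV :: int set)"
    and nz: "\<exists>k. \<phi> k \<noteq> 0"
    using mathieu_fourier_coeff[OF s y] by (simp_all add: \<phi>_def l_def)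
  have "cform s \<phi> = l * cmass \<phi>"
    using complex_eigenseq_parts[OF rec fin, THEN eigenseq_form]
    by (simp add: cform_def cmass_def distrib_left)
  with ground_le_cform[OF s fin] have "ground s * cmass \<phi> \<le> l * cmass \<phi>" by simp
  moreover have "cmass \<phi> > 0" using nz cmass_pos[OF fin] by blast
  ultimately have "ground s \<le> l" by simp
  then show "4 * (ground s - 1) / s \<le> a"
    using s by (simp add: l_def field_simps)
qed

text \<open>Identifies the objective with the Lagrange dual function of the constrained
  problem.\<close>

lemma mathieu_obj_ground: "s > 0 \<Longrightarrow> mathieu_obj E s = ground s - s * E"
  using a0_minus[of "2 / s"] a0_ground[of s] by (simp add: mathieu_obj_def field_simps)

text \<open>Real and imaginary parts may violate the energy bound separately, so the estimate goes
  through the optimal multiplier, where lower bounds add.\<close>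

lemma min_error_le_cform:
  assumes E: "E > 0" and fin: "(\<lambda>k. (of_int k)\<^sup>2 * (cmod (\<phi> k))\<^sup>2) summable_on (UNIV :: int set)"
    and "cmass \<phi> = 1" "(\<Sum>\<^sub>\<infinity>k. (of_int k)\<^sup>2 * (cmod (\<phi> k))\<^sup>2) \<le> E"
  shows "min_error E \<le> cform 0 \<phi>"
proof -
  obtain s where s: "s > 0" "ground s = min_error E + s * E"
    using min_error_supporting_line[OF E] by blast
  have "min_error E + s * E \<le> cform s \<phi>"
    using ground_le_cform[OF s(1) fin] assms(3) s(2) by simp
  also have "\<dots> \<le> cform 0 \<phi> + s * E"
    unfolding cform_eq[OF fin, of s] using s(1) assms(4) by simp
  finally show ?thesis by simp
qed

section \<open>Transfer to wave functions and to the estimation problem\<close>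

lemma L2p_even_unit_integrable:
  assumes "f \<in> L2p_even_unit"
  shows "integrable circle f"
proof -
  interpret finite_measure circle by (rule finite_measure_circle)
  have sq: "integrable circle (\<lambda>\<theta>. (cmod (f \<theta>))\<^sup>2)"
    using assms by (simp add: L2p_even_unit_def set_integrable_circle)
  show ?thesis
  proof (rule Bochner_Integration.integrable_bound)
    show "integrable circle (\<lambda>\<theta>. 1 + (cmod (f \<theta>))\<^sup>2)" using sq by simp
    show "f \<in> borel_measurable circle"
      using assms by (intro measurable_circle_borel) (simp add: L2p_even_unit_def)
    have "x \<le> 1 + x\<^sup>2" for x :: real
    proof -
      have "2 * x \<le> x\<^sup>2 + 1" using sum_squares_bound[of x 1] by simp
      then show ?thesis using zero_le_power2[of x] by linarith
    qed
    then show "AE \<theta> in circle. norm (f \<theta>) \<le> norm (1 + (cmod (f \<theta>))\<^sup>2)"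
      by (intro AE_I2) (simp add: abs_of_nonneg)
  qed
qed

lemma L2p_even_unit_coeff:
  assumes f: "f \<in> L2p_even_unit" and "finite_P2 f"
  shows "cmass (fourier_coeff f) = 1" "one_minus_cosQ_expect f = cform 0 (fourier_coeff f)"
proof -
  have fin: "(\<lambda>k. (of_int k)\<^sup>2 * (cmod (fourier_coeff f k))\<^sup>2) summable_on (UNIV :: int set)"
    using assms(2) by (simp add: finite_P2_def)
  let ?F = "fseries (fourier_coeff f)"
  have abs: "(\<lambda>k. norm (fourier_coeff f k)) summable_on UNIV"
    by (rule energy_imp_abs_summable[OF fin])
  have ae: "AE \<theta> in circle. f \<theta> = ?F \<theta>"
    by (rule AE_eq_fseries[OF L2p_even_unit_integrable[OF f] abs])
  have [measurable]: "f \<in> borel_measurable circle" "?F \<in> borel_measurable circle"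
    "(\<lambda>\<theta>. cos \<theta>) \<in> borel_measurable circle"
    using L2p_even_unit_integrable[OF f] measurable_circle_borel[OF fseries_measurable[OF abs]]
    by (auto intro!: continuous_measurable_circle[of cos] continuous_intros)
  have norm_eq: "integral\<^sup>L circle (\<lambda>\<theta>. (cmod (f \<theta>))\<^sup>2) = integral\<^sup>L circle (\<lambda>\<theta>. (cmod (?F \<theta>))\<^sup>2)"
    by (rule integral_cong_AE) (use ae in \<open>auto elim: eventually_mono\<close>)
  show "cmass (fourier_coeff f) = 1"
    using f unfolding L2p_even_unit_def mem_Collect_eq set_lebesgue_integral_circle norm_eq parseval[OF fin]
    by blast
  have "integral\<^sup>L circle (\<lambda>\<theta>. (1 - cos \<theta>) * (cmod (f \<theta>))\<^sup>2) = integral\<^sup>L circle (\<lambda>\<theta>. (1 - cos \<theta>) * (cmod (?F \<theta>))\<^sup>2)"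
    by (rule integral_cong_AE) (use ae in \<open>auto elim: eventually_mono\<close>)
  then show "one_minus_cosQ_expect f = cform 0 (fourier_coeff f)"
    using integral_error_fseries[OF fin]
    by (simp add: one_minus_cosQ_expect_def set_lebesgue_integral_circle)
qed

lemma kappa_U1_attained:
  assumes E: "E > 0"
  shows "kappa_U1 E = min_error E"
    and "\<exists>f\<in>L2p_even_unit. finite_P2 f \<and> P2_expect f \<le> E \<and> one_minus_cosQ_expect f = min_error E"
proof -
  obtain s where s: "s > 0" "ground s = min_error E + s * E"
    using min_error_supporting_line[OF E] by blast
  obtain u where u: "u \<in> form_dom" "mass u = 1" "energy u \<le> E" "1 - hop u = min_error E"
    using min_error_attained[of E] E by (metis less_imp_le)
  \<comment> \<open>A primal minimizer is a ground state for the optimal multiplier, hence even; the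
    minimum over all sequences is thus reached by an even wave function.\<close>
  have "form s u \<le> ground s"
    using u s by (simp add: form_def)
  then have "eigenseq s (ground s) u"
    using ground_le_form[OF s(1) u(1)] u(2) by (intro ground_state_eigenseq[OF s(1) u(1)]) simp
  then have even: "u (- k) = u k" for k
    by (rule ground_state_even[OF s(1)])
  define \<phi> where "\<phi> k = complex_of_real (u k)" for k
  have fin: "(\<lambda>k. (of_int k)\<^sup>2 * (cmod (\<phi> k))\<^sup>2) summable_on (UNIV :: int set)"
    using form_domD(2)[OF u(1)] by (simp add: \<phi>_def)
  have abs: "(\<lambda>k. norm (\<phi> k)) summable_on UNIV"
    by (rule energy_imp_abs_summable[OF fin])
  define f where "f = fseries \<phi>"
  have coeff: "fourier_coeff f = \<phi>"
    by (rule ext) (simp add: f_def fourier_coeff_fseries[OF abs])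
  have zero: "mass (\<lambda>_. 0) = 0" by (simp add: mass_def)
  interpret finite_measure circle by (rule finite_measure_circle)
  have "f \<in> L2p_even_unit"
    unfolding L2p_even_unit_def mem_Collect_eq set_integrable_circle set_lebesgue_integral_circle
  proof (intro conjI ballI)
    show "f \<in> borel_measurable borel"
      unfolding f_def by (rule fseries_measurable[OF abs])
    have "(cmod (f \<theta>))\<^sup>2 \<le> (\<Sum>\<^sub>\<infinity>k. norm (\<phi> k))\<^sup>2" for \<theta>
      unfolding f_def using norm_fseries_le[OF abs] by (intro power_mono) auto
    moreover have "f \<in> borel_measurable circle"
      unfolding f_def by (intro measurable_circle_borel fseries_measurable[OF abs])
    ultimately show "integrable circle (\<lambda>\<theta>. (cmod (f \<theta>))\<^sup>2)"
      by (intro integrable_const_bound[where B = "(\<Sum>\<^sub>\<infinity>k. norm (\<phi> k))\<^sup>2"]) auto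
    show "integral\<^sup>L circle (\<lambda>\<theta>. (cmod (f \<theta>))\<^sup>2) / (2 * pi) = 1"
    proof -
      have "cmass \<phi> = 1" by (simp add: cmass_def \<phi>_def u(2) zero)
      then show ?thesis by (simp add: f_def parseval[OF fin])
    qed
    fix \<theta>
    have "f (- \<theta>) = (\<Sum>\<^sub>\<infinity>k. (\<lambda>k. \<phi> k * cis (of_int k * \<theta>)) (- k))"
      by (simp add: f_def fseries_def \<phi>_def even)
    also have "\<dots> = f \<theta>"
      unfolding f_def fseries_def by (rule summable_on_uminus_int(2))
    finally show "f (- \<theta>) = f \<theta>" .
  qed
  moreover have "finite_P2 f"
    using fin by (simp add: finite_P2_def coeff)
  moreover have "P2_expect f \<le> E"
    using u(3) by (simp add: P2_expect_def coeff \<phi>_def energy_def)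
  moreover from calculation(1,2) have "one_minus_cosQ_expect f = min_error E"
    using L2p_even_unit_coeff(2)[of f] u(2,4)
    by (simp add: coeff cform_def form_def \<phi>_def mass_def energy_def hop_def)
  ultimately show att: "\<exists>f\<in>L2p_even_unit. finite_P2 f \<and> P2_expect f \<le> E \<and> one_minus_cosQ_expect f = min_error E"
    by blast
  show "kappa_U1 E = min_error E"
    unfolding kappa_U1_def
  proof (rule cInf_eq_minimum)
    show "min_error E \<in> one_minus_cosQ_expect ` {f \<in> L2p_even_unit. finite_P2 f \<and> P2_expect f \<le> E}"
      using att by (auto simp: image_iff)
    fix x assume "x \<in> one_minus_cosQ_expect ` {f \<in> L2p_even_unit. finite_P2 f \<and> P2_expect f \<le> E}"
    then obtain g where g: "g \<in> L2p_even_unit" "finite_P2 g" "P2_expect g \<le> E" "x = one_minus_cosQ_expect g"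
      by blast
    show "min_error E \<le> x"
      unfolding g(4) L2p_even_unit_coeff(2)[OF g(1,2)]
      by (rule min_error_le_cform[OF E])
         (use g L2p_even_unit_coeff(1)[OF g(1,2)] in \<open>auto simp: finite_P2_def P2_expect_def\<close>)
  qed
qed

text \<open>Both directions identify optimality of the input state with being a ground state of the dual
  problem: one by complementary slackness, the other by \<open>dual_ground_state_hop\<close>.\<close>
lemma optimal_iff_mathieu:
  assumes E: "E > 0" and s: "s > 0" and dual: "ground s = min_error E + s * E"
    and fin: "(\<lambda>k. (of_int k)\<^sup>2 * (cmod (\<phi> k))\<^sup>2) summable_on (UNIV :: int set)"
    and unit: "cmass \<phi> = 1" and energy: "(\<Sum>\<^sub>\<infinity>k. (of_int k)\<^sup>2 * (cmod (\<phi> k))\<^sup>2) \<le> E"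
  shows "cform 0 \<phi> = min_error E \<longleftrightarrow>
    (\<exists>y c. mathieu_eigfun (- 2 / s) (a0 (- 2 / s)) y \<and>
      (\<forall>\<theta>\<in>{-pi<..pi}. fseries \<phi> \<theta> = c * of_real (y (\<theta> / 2))))"
proof
  assume opt: "cform 0 \<phi> = min_error E"
  obtain g where g: "eigenseq s (ground s) g" "mass g = 1"
    using ground_state_exists[OF s] by blast
  \<comment> \<open>Each part satisfies the reverse inequality, so this bound on the sum forces
    equality in both.\<close>
  have "cform s \<phi> \<le> ground s * cmass \<phi>"
    unfolding cform_eq[OF fin, of s] opt using s energy by (simp add: unit dual)
  then have "form s (\<lambda>k. Re (\<phi> k)) = ground s * mass (\<lambda>k. Re (\<phi> k))"
    "form s (\<lambda>k. Im (\<phi> k)) = ground s * mass (\<lambda>k. Im (\<phi> k))"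
    using ground_le_form[OF s complex_form_dom(1)[OF fin]] ground_le_form[OF s complex_form_dom(2)[OF fin]]
    unfolding cform_def cmass_def distrib_left by linarith+
  then have "eigenseq s (ground s) (\<lambda>k. Re (\<phi> k))" "eigenseq s (ground s) (\<lambda>k. Im (\<phi> k))"
    using complex_form_dom[OF fin] by (auto intro: ground_state_eigenseq[OF s])
  then obtain t1 t2 where t: "(\<lambda>k. Re (\<phi> k)) = (\<lambda>k. t1 * g k)" "(\<lambda>k. Im (\<phi> k)) = (\<lambda>k. t2 * g k)"
    using ground_state_unique[OF s g(1)] g(2) by (metis zero_neq_one)
  define c where "c = Complex t1 t2"
  have \<phi>: "\<phi> k = c * of_real (g k)" for k
    using fun_cong[OF t(1), of k] fun_cong[OF t(2), of k] by (simp add: c_def complex_eq_iff)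
  obtain y where y: "mathieu_eigfun (- 2 / s) (4 * (ground s - 1) / s) y"
    "\<And>\<theta>. fseries (\<lambda>k. of_real (g k)) \<theta> = of_real (y (\<theta> / 2))"
    using eigenseq_mathieu[OF s g(1) ground_state_even[OF s g(1)]] g(2) by (metis zero_neq_one)
  have "fseries \<phi> \<theta> = c * fseries (\<lambda>k. of_real (g k)) \<theta>" for \<theta>
    unfolding fseries_def \<phi> mult.assoc by (rule infsum_cmult_right')
  then show "\<exists>y c. mathieu_eigfun (- 2 / s) (a0 (- 2 / s)) y \<and>
      (\<forall>\<theta>\<in>{-pi<..pi}. fseries \<phi> \<theta> = c * of_real (y (\<theta> / 2)))"
    using y unfolding a0_ground[OF s] by metis
next
  assume "\<exists>y c. mathieu_eigfun (- 2 / s) (a0 (- 2 / s)) y \<and>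
      (\<forall>\<theta>\<in>{-pi<..pi}. fseries \<phi> \<theta> = c * of_real (y (\<theta> / 2)))"
  then obtain y c where y: "mathieu_eigfun (- 2 / s) (a0 (- 2 / s)) y"
    and eq: "\<And>\<theta>. \<theta> \<in> {-pi<..pi} \<Longrightarrow> fseries \<phi> \<theta> = c * of_real (y (\<theta> / 2))"
    by blast
  let ?\<eta> = "fourier_coeff (\<lambda>\<theta>. of_real (y (\<theta> / 2)))"
  have "s * a0 (- 2 / s) / 4 + 1 = ground s"
    by (subst a0_ground[OF s]) (use s in \<open>simp add: field_simps\<close>)
  then have rec: "complex_eigenseq s (ground s) ?\<eta>"
    using mathieu_fourier_coeff(1)[OF s y] by simp
  \<comment> \<open>Coefficients are integrals over one period, where the two functions agree up to
    the factor c.\<close>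
  have \<phi>: "\<phi> k = c * ?\<eta> k" for k
  proof -
    have "\<phi> k = fourier_coeff (fseries \<phi>) k"
      by (simp add: fourier_coeff_fseries[OF energy_imp_abs_summable[OF fin]])
    also have "integral\<^sup>L circle (\<lambda>\<theta>. cis (of_int (- k) * \<theta>) * fseries \<phi> \<theta>)
        = integral\<^sup>L circle (\<lambda>\<theta>. c * (cis (of_int (- k) * \<theta>) * of_real (y (\<theta> / 2))))"
      by (rule Bochner_Integration.integral_cong) (use eq in \<open>auto simp: mult_ac\<close>)
    then have "fourier_coeff (fseries \<phi>) k = c * ?\<eta> k"
      unfolding fourier_coeff_circle by simp
    finally show ?thesis .
  qed
  have "complex_eigenseq s (ground s) \<phi>"
    unfolding complex_eigenseq_def
  proof
    fix k
    have "of_real (s * (of_int k)\<^sup>2 + 1 - ground s) * \<phi> k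
        = c * (of_real (s * (of_int k)\<^sup>2 + 1 - ground s) * ?\<eta> k)"
      by (simp only: \<phi> mult_ac)
    also have "\<dots> = c * ((?\<eta> (k + 1) + ?\<eta> (k - 1)) / 2)"
      using rec unfolding complex_eigenseq_def by metis
    also have "\<dots> = (\<phi> (k + 1) + \<phi> (k - 1)) / 2"
      by (simp only: \<phi> distrib_left times_divide_eq_right)
    finally show "of_real (s * (of_int k)\<^sup>2 + 1 - ground s) * \<phi> k = (\<phi> (k + 1) + \<phi> (k - 1)) / 2" .
  qed
  from dual_ground_state_hop[OF s E dual complex_eigenseq_parts(1)[OF this fin]]
    dual_ground_state_hop[OF s E dual complex_eigenseq_parts(2)[OF this fin]]
  have "cform 0 \<phi> = cmass \<phi> - (1 - min_error E) * cmass \<phi>"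
    by (simp add: cform_def form_def cmass_def distrib_left)
  then show "cform 0 \<phi> = min_error E" by (simp add: unit)
qed

theorem theorem8:
  fixes E :: real
  assumes "E > 0"
  shows "(\<exists>f\<in>L2p_even_unit. finite_P2 f \<and> P2_expect f \<le> E \<and>
             one_minus_cosQ_expect f = kappa_U1 E)
       \<and> (\<exists>s0>0. (\<forall>s>0. mathieu_obj E s \<le> mathieu_obj E s0) \<and> kappa_U1 E = mathieu_obj E s0)
       \<and> (\<forall>sE>0. (\<forall>s>0. mathieu_obj E s \<le> mathieu_obj E sE) \<longrightarrow>
            (\<forall>\<phi>::int \<Rightarrow> complex. l2_unit \<phi> \<and> finite_H \<phi> \<and> H_expect \<phi> \<le> E \<longrightarrow>
               (covI_error \<phi> = kappa_U1 E \<longleftrightarrow>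
                 (\<exists>y c. mathieu_eigfun (-2 / sE) (a0 (-2 / sE)) y \<and>
                        (\<forall>\<theta>\<in>{-pi<..pi}. Finv \<phi> \<theta> = c * of_real (y (\<theta> / 2)))))))"
proof (intro conjI allI impI)
  note kappa = kappa_U1_attained[OF assms]
  show "\<exists>f\<in>L2p_even_unit. finite_P2 f \<and> P2_expect f \<le> E \<and> one_minus_cosQ_expect f = kappa_U1 E"
    using kappa by simp
  have obj_le: "mathieu_obj E s \<le> min_error E" if "s > 0" for s
    using ground_le_min_error[OF that assms] by (simp add: mathieu_obj_ground that)
  obtain s0 where s0: "s0 > 0" "ground s0 = min_error E + s0 * E"
    using min_error_supporting_line[OF assms] by blast
  then have obj0: "mathieu_obj E s0 = min_error E"
    by (simp add: mathieu_obj_ground)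
  show "\<exists>s0>0. (\<forall>s>0. mathieu_obj E s \<le> mathieu_obj E s0) \<and> kappa_U1 E = mathieu_obj E s0"
    using s0(1) obj_le obj0 kappa(1) by (intro exI[of _ s0]) simp
  fix sE :: real and \<phi> :: "int \<Rightarrow> complex"
  assume sE: "sE > 0" and max: "\<forall>s>0. mathieu_obj E s \<le> mathieu_obj E sE"
    and \<phi>: "l2_unit \<phi> \<and> finite_H \<phi> \<and> H_expect \<phi> \<le> E"
  \<comment> \<open>Any maximizer reaches the dual optimum, so the multiplier identity holds at the
    given \<open>sE\<close>, not only at the slope \<open>s0\<close> of a supporting line.\<close>
  have "mathieu_obj E sE = min_error E"
    using max s0(1) obj0 obj_le[OF sE] by (intro antisym) auto
  then have dual: "ground sE = min_error E + sE * E"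
    by (simp add: mathieu_obj_ground[OF sE])
  define \<psi> where "\<psi> k = \<phi> (- k)" for k
  have fin: "(\<lambda>k. (of_int k)\<^sup>2 * (cmod (\<psi> k))\<^sup>2) summable_on (UNIV :: int set)"
    using \<phi> summable_on_uminus_int(1)[of "\<lambda>k. (of_int k)\<^sup>2 * (cmod (\<phi> k))\<^sup>2"]
    by (simp add: finite_H_def \<psi>_def)
  have unit: "cmass \<psi> = 1"
    using \<phi> summable_on_uminus_int(2)[of "\<lambda>k. (cmod (\<phi> k))\<^sup>2"]
    by (simp add: l2_unit_def \<psi>_def flip: cmass_eq[OF fin])
  have energy: "(\<Sum>\<^sub>\<infinity>k. (of_int k)\<^sup>2 * (cmod (\<psi> k))\<^sup>2) \<le> E"
    using \<phi> summable_on_uminus_int(2)[of "\<lambda>k. (of_int k)\<^sup>2 * (cmod (\<phi> k))\<^sup>2"]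
    by (simp add: H_expect_def \<psi>_def)
  have Finv: "Finv \<phi> \<theta> = fseries \<psi> \<theta>" for \<theta>
    by (simp add: Finv_eq_fseries \<psi>_def[abs_def])
  have "covI_error \<phi> = cform 0 \<psi>"
    using integral_error_fseries[OF fin]
    by (simp add: covI_error_def set_lebesgue_integral_circle Finv)
  then show "covI_error \<phi> = kappa_U1 E \<longleftrightarrow>
      (\<exists>y c. mathieu_eigfun (-2 / sE) (a0 (-2 / sE)) y \<and>
        (\<forall>\<theta>\<in>{-pi<..pi}. Finv \<phi> \<theta> = c * of_real (y (\<theta> / 2))))"
    unfolding kappa(1) Finv using optimal_iff_mathieu[OF assms sE dual fin unit energy] by simp
qed

end
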